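(* There exists a positive constant $C$ such that for every $\bm{B}_h\in H_0^h(\mathrm{div},\Omega)$ with $\nabla\cdot\bm{B}_h=0$ and every $\bm{A}_h\in H_0^h(\mathrm{curl},\Omega)$ with $\nabla\times\bm{A}_h=\bm{B}_h$, $$\mathcal{H}_m:=\int_\Omega\bm{B}_h\cdot\bm{A}_h\,dx\le C\,\|\bm{B}_h\|^2 .$$
   Context: $\Omega\subset\mathbb{R}^3$ is a contractible bounded Lipschitz domain with unit outer normal $\bm{n}$; $\|\cdot\|$ is the $L^2(\Omega)$ norm. $H_0(\mathrm{grad},\Omega)$, $H_0(\mathrm{curl},\Omega)$, $H_0(\mathrm{div},\Omega)$ are the usual spaces of $L^2$ fields with $L^2$ gradient/curl/divergence and vanishing trace $v$, $v\times \bm{n}$, $v\cdot\bm{n}$ on $\partial\Omega$, respectively; $L^2_0(\Omega)$ is the space of mean-zero $L^2$ functions. $H_0^h(\mathrm{grad},\Omega)$, $H_0^h(\mathrm{curl},\Omega)$, $H_0^h(\mathrm{div},\Omega)$, $L_0^{2,h}(\Omega)$ are finite-dimensional (piecewise polynomial finite element) subspaces of these spaces forming a discrete de Rham complex $$0\to H_0^h(\mathrm{grad},\Omega)\xrightarrow{\mathrm{grad}} H_0^h(\mathrm{curl},\Omega)\xrightarrow{\mathrm{curl}} H_0^h(\mathrm{div},\Omega)\xrightarrow{\mathrm{div}} L_0^{2,h}(\Omega)\to 0,$$ which is exact. *)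

theory Defs
  imports "HOL-Analysis.Analysis"
begin

definition partial :: "3 \<Rightarrow> (real^3 \<Rightarrow> real) \<Rightarrow> real^3 \<Rightarrow> real" where
  "partial i f x = frechet_derivative f (at x) (axis i 1)"

definition gradient :: "(real^3 \<Rightarrow> real) \<Rightarrow> real^3 \<Rightarrow> real^3" where
  "gradient f x = (\<chi> i. partial i f x)"

definition divergence :: "(real^3 \<Rightarrow> real^3) \<Rightarrow> real^3 \<Rightarrow> real" where
  "divergence F x = (\<Sum>i\<in>UNIV. partial i (\<lambda>y. F y $ i) x)"

definition curl :: "(real^3 \<Rightarrow> real^3) \<Rightarrow> real^3 \<Rightarrow> real^3" where
  "curl F x = vector
     [partial 2 (\<lambda>y. F y $ 3) x - partial 3 (\<lambda>y. F y $ 2) x,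
      partial 3 (\<lambda>y. F y $ 1) x - partial 1 (\<lambda>y. F y $ 3) x,
      partial 1 (\<lambda>y. F y $ 2) x - partial 2 (\<lambda>y. F y $ 1) x]"

primrec C_k :: "nat \<Rightarrow> (real^3 \<Rightarrow> real) \<Rightarrow> bool" where
  "C_k 0 f \<longleftrightarrow> continuous_on UNIV f"
| "C_k (Suc k) f \<longleftrightarrow> (\<forall>x. f differentiable (at x)) \<and> (\<forall>i. C_k k (partial i f))"

definition smooth :: "(real^3 \<Rightarrow> real) \<Rightarrow> bool" where
  "smooth f \<longleftrightarrow> (\<forall>k. C_k k f)"

definition smooth_field :: "(real^3 \<Rightarrow> real^3) \<Rightarrow> bool" where
  "smooth_field F \<longleftrightarrow> (\<forall>i. smooth (\<lambda>x. F x $ i))"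

definition compact_support_in :: "(real^3) set \<Rightarrow> (real^3 \<Rightarrow> 'b::zero) \<Rightarrow> bool" where
  "compact_support_in \<Omega> f \<longleftrightarrow> (\<exists>K. compact K \<and> K \<subseteq> \<Omega> \<and> (\<forall>x. x \<notin> K \<longrightarrow> f x = 0))"

text \<open>
  Near every boundary point the domain is, in suitable Cartesian coordinates, the strict
  epigraph of a Lipschitz function of the first two coordinates.
\<close>

definition lipschitz_domain :: "(real^3) set \<Rightarrow> bool" where
  "lipschitz_domain \<Omega> \<longleftrightarrow>
     open \<Omega> \<and> connected \<Omega> \<and> \<Omega> \<noteq> {} \<and>
     (\<forall>p \<in> frontier \<Omega>. \<exists>r > 0. \<exists>R :: real^3 \<Rightarrow> real^3. \<exists>L. \<exists>\<gamma> :: real \<times> real \<Rightarrow> real.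
        orthogonal_transformation R \<and> L-lipschitz_on UNIV \<gamma> \<and>
        (\<forall>x \<in> ball p r. x \<in> \<Omega> \<longleftrightarrow> \<gamma> (R x $ 1, R x $ 2) < R x $ 3))"

text \<open>
  Elements of \<open>L\<^sup>2(\<Omega>)\<close> are represented by functions on the whole space of which only the
  values on \<open>\<Omega>\<close> matter, up to equality almost everywhere. All predicates below are
  invariant under a change of representative, and all spaces are sets containing, with a
  function, all representatives of its class.
\<close>

definition L2 :: "(real^3) set \<Rightarrow> (real^3 \<Rightarrow> 'b::euclidean_space) set" where
  "L2 \<Omega> = {v \<in> borel_measurable (lebesgue_on \<Omega>).
             integrable (lebesgue_on \<Omega>) (\<lambda>x. (norm (v x))\<^sup>2)}"

definition L2_norm :: "(real^3) set \<Rightarrow> (real^3 \<Rightarrow> 'b::euclidean_space) \<Rightarrow> real" where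
  "L2_norm \<Omega> v = sqrt (LINT x|lebesgue_on \<Omega>. (norm (v x))\<^sup>2)"

definition has_weak_grad :: "(real^3) set \<Rightarrow> (real^3 \<Rightarrow> real) \<Rightarrow> (real^3 \<Rightarrow> real^3) \<Rightarrow> bool" where
  "has_weak_grad \<Omega> u g \<longleftrightarrow> u \<in> L2 \<Omega> \<and> g \<in> L2 \<Omega> \<and>
     (\<forall>\<Phi>. smooth_field \<Phi> \<and> compact_support_in \<Omega> \<Phi> \<longrightarrow>
        (LINT x|lebesgue_on \<Omega>. g x \<bullet> \<Phi> x) = - (LINT x|lebesgue_on \<Omega>. u x * divergence \<Phi> x))"

definition has_weak_curl :: "(real^3) set \<Rightarrow> (real^3 \<Rightarrow> real^3) \<Rightarrow> (real^3 \<Rightarrow> real^3) \<Rightarrow> bool" where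
  "has_weak_curl \<Omega> v w \<longleftrightarrow> v \<in> L2 \<Omega> \<and> w \<in> L2 \<Omega> \<and>
     (\<forall>\<Phi>. smooth_field \<Phi> \<and> compact_support_in \<Omega> \<Phi> \<longrightarrow>
        (LINT x|lebesgue_on \<Omega>. w x \<bullet> \<Phi> x) = (LINT x|lebesgue_on \<Omega>. v x \<bullet> curl \<Phi> x))"

definition has_weak_div :: "(real^3) set \<Rightarrow> (real^3 \<Rightarrow> real^3) \<Rightarrow> (real^3 \<Rightarrow> real) \<Rightarrow> bool" where
  "has_weak_div \<Omega> v q \<longleftrightarrow> v \<in> L2 \<Omega> \<and> q \<in> L2 \<Omega> \<and>
     (\<forall>\<phi>. smooth \<phi> \<and> compact_support_in \<Omega> \<phi> \<longrightarrow>
        (LINT x|lebesgue_on \<Omega>. q x * \<phi> x) = - (LINT x|lebesgue_on \<Omega>. v x \<bullet> gradient \<phi> x))"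

text \<open>
  The traces of fields that are merely in \<open>H(grad)\<close>, \<open>H(curl)\<close>, \<open>H(div)\<close> are the functionals
  on the boundary given by the boundary term of Green's formula. With \<open>n\<close> the unit outer
  normal and a test function smooth up to the boundary, the three functionals below are
  the integrals over the boundary of \<open>u n \<bullet> \<Phi>\<close>, \<open>(v \<times> n) \<bullet> \<Phi>\<close> and \<open>(v \<bullet> n) \<phi>\<close>. The second
  arguments are the weak gradient, curl and divergence of the first.
\<close>

definition trace_grad ::
  "(real^3) set \<Rightarrow> (real^3 \<Rightarrow> real) \<Rightarrow> (real^3 \<Rightarrow> real^3) \<Rightarrow> (real^3 \<Rightarrow> real^3) \<Rightarrow> real" where
  "trace_grad \<Omega> u g \<Phi> =
     (LINT x|lebesgue_on \<Omega>. u x * divergence \<Phi> x) + (LINT x|lebesgue_on \<Omega>. g x \<bullet> \<Phi> x)"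

definition trace_curl ::
  "(real^3) set \<Rightarrow> (real^3 \<Rightarrow> real^3) \<Rightarrow> (real^3 \<Rightarrow> real^3) \<Rightarrow> (real^3 \<Rightarrow> real^3) \<Rightarrow> real" where
  "trace_curl \<Omega> v w \<Phi> =
     (LINT x|lebesgue_on \<Omega>. v x \<bullet> curl \<Phi> x) - (LINT x|lebesgue_on \<Omega>. w x \<bullet> \<Phi> x)"

definition trace_div ::
  "(real^3) set \<Rightarrow> (real^3 \<Rightarrow> real^3) \<Rightarrow> (real^3 \<Rightarrow> real) \<Rightarrow> (real^3 \<Rightarrow> real) \<Rightarrow> real" where
  "trace_div \<Omega> v q \<phi> =
     (LINT x|lebesgue_on \<Omega>. v x \<bullet> gradient \<phi> x) + (LINT x|lebesgue_on \<Omega>. q x * \<phi> x)"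

definition H0_grad :: "(real^3) set \<Rightarrow> (real^3 \<Rightarrow> real) set" where
  "H0_grad \<Omega> = {u. \<exists>g. has_weak_grad \<Omega> u g \<and> (\<forall>\<Phi>. smooth_field \<Phi> \<longrightarrow> trace_grad \<Omega> u g \<Phi> = 0)}"

definition H0_curl :: "(real^3) set \<Rightarrow> (real^3 \<Rightarrow> real^3) set" where
  "H0_curl \<Omega> = {v. \<exists>w. has_weak_curl \<Omega> v w \<and> (\<forall>\<Phi>. smooth_field \<Phi> \<longrightarrow> trace_curl \<Omega> v w \<Phi> = 0)}"

definition H0_div :: "(real^3) set \<Rightarrow> (real^3 \<Rightarrow> real^3) set" where
  "H0_div \<Omega> = {v. \<exists>q. has_weak_div \<Omega> v q \<and> (\<forall>\<phi>. smooth \<phi> \<longrightarrow> trace_div \<Omega> v q \<phi> = 0)}"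

definition L2_mean_zero :: "(real^3) set \<Rightarrow> (real^3 \<Rightarrow> real) set" where
  "L2_mean_zero \<Omega> = {q \<in> L2 \<Omega>. (LINT x|lebesgue_on \<Omega>. q x) = 0}"

text \<open>
  Neither the shape of the mesh cells nor the polynomial degree is restricted, so simplicial,
  hexahedral and curved meshes are all covered.
\<close>

definition mesh :: "(real^3) set \<Rightarrow> (real^3) set set \<Rightarrow> bool" where
  "mesh \<Omega> \<T> \<longleftrightarrow> finite \<T> \<and> disjoint \<T> \<and>
     (\<forall>K\<in>\<T>. open K \<and> K \<noteq> {} \<and> K \<subseteq> \<Omega>) \<and> negligible (\<Omega> - \<Union>\<T>)"

definition piecewise_polynomial ::
  "(real^3) set set \<Rightarrow> (real^3 \<Rightarrow> 'b::euclidean_space) \<Rightarrow> bool" where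
  "piecewise_polynomial \<T> v \<longleftrightarrow>
     (\<forall>K\<in>\<T>. \<exists>p. polynomial_function p \<and> (AE x in lebesgue_on K. v x = p x))"

text \<open>
  \<open>V\<close> is a finite-dimensional subspace of \<open>X\<close>: modulo equality almost everywhere, it is the
  span of finitely many fields.
\<close>

definition fe_subspace ::
  "(real^3) set \<Rightarrow> (real^3) set set \<Rightarrow> (real^3 \<Rightarrow> 'b::euclidean_space) set \<Rightarrow>
   (real^3 \<Rightarrow> 'b) set \<Rightarrow> bool" where
  "fe_subspace \<Omega> \<T> X V \<longleftrightarrow>
     V \<subseteq> X \<and> (\<forall>v\<in>V. piecewise_polynomial \<T> v) \<and>
     (\<exists>bs. finite bs \<and>
        V = {v. \<exists>c :: (real^3 \<Rightarrow> 'b) \<Rightarrow> real.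
                  AE x in lebesgue_on \<Omega>. v x = (\<Sum>b\<in>bs. c b *\<^sub>R b x)})"

text \<open>
  The four set equations express that the complex is exact at each of its four spaces; they include that
  every operator maps its space into the next one.
\<close>

definition exact_discrete_de_Rham ::
  "(real^3) set \<Rightarrow> (real^3 \<Rightarrow> real) set \<Rightarrow> (real^3 \<Rightarrow> real^3) set \<Rightarrow>
   (real^3 \<Rightarrow> real^3) set \<Rightarrow> (real^3 \<Rightarrow> real) set \<Rightarrow> bool" where
  "exact_discrete_de_Rham \<Omega> Vgrad Vcurl Vdiv Q \<longleftrightarrow>
     (\<exists>\<T>. mesh \<Omega> \<T> \<and>
        fe_subspace \<Omega> \<T> (H0_grad \<Omega>) Vgrad \<and> fe_subspace \<Omega> \<T> (H0_curl \<Omega>) Vcurl \<and>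
        fe_subspace \<Omega> \<T> (H0_div \<Omega>) Vdiv \<and> fe_subspace \<Omega> \<T> (L2_mean_zero \<Omega>) Q) \<and>
     {u \<in> Vgrad. has_weak_grad \<Omega> u (\<lambda>_. 0)} = {u. AE x in lebesgue_on \<Omega>. u x = 0} \<and>
     {g. \<exists>u\<in>Vgrad. has_weak_grad \<Omega> u g} = {v \<in> Vcurl. has_weak_curl \<Omega> v (\<lambda>_. 0)} \<and>
     {w. \<exists>v\<in>Vcurl. has_weak_curl \<Omega> v w} = {w \<in> Vdiv. has_weak_div \<Omega> w (\<lambda>_. 0)} \<and>
     {q. \<exists>w\<in>Vdiv. has_weak_div \<Omega> w q} = Q"

end

theory Submission
  imports Defs
begin

text \<open>
  The helicity does not depend on the choice of the potential, and this freedom gives a bound that is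
  uniform in the discretisation. A field \<open>A\<close> in \<open>H\<^sub>0(curl)\<close> with curl \<open>B\<close>, extended by zero, satisfies
  \<open>curl A = B\<close> on all of \<open>\<real>\<^sup>3\<close>, since the vanishing trace says exactly that \<open>\<integral> A \<bullet> curl \<Phi> = \<integral> B \<bullet> \<Phi>\<close>
  for every smooth \<open>\<Phi>\<close>, whatever its values on the boundary. If \<open>A'\<close> is any other potential of \<open>B\<close>, it
  can be used as the test field, and \<open>\<integral> A \<bullet> B = \<integral> A \<bullet> curl A' = \<integral> B \<bullet> A'\<close>. It thus suffices to find
  one potential on \<open>\<Omega>\<close> whose \<open>L\<^sup>2\<close> norm is bounded by that of \<open>B\<close>, and it need not satisfy any boundary
  condition.

  Such a potential is explicit. As \<open>B\<close> is divergence free on \<open>\<real>\<^sup>3\<close> and vanishes below a plane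
  \<open>x\<^sub>3 = a\<close>, the field with components \<open>\<integral> B\<^sub>2\<close>, \<open>- \<integral> B\<^sub>1\<close> and \<open>0\<close>, where the integrals run from \<open>a\<close> to
  \<open>x\<^sub>3\<close> in the third variable, has curl \<open>B\<close>. If \<open>\<Omega>\<close> lies in the cube \<open>[- m, m]\<^sup>3\<close>, the form
  \<open>\<integral> B \<bullet> A'\<close> is at most \<open>2 m \<parallel>B\<parallel>\<^sup>2\<close>.

  Since \<open>A'\<close> is not smooth, \<open>B\<close> is first mollified with a polynomial kernel. The lemma
  \<open>curl_potential\<close> computes the curl of the resulting smooth potential: it is the mollified field up to an
  error located on the plane \<open>x\<^sub>3 = a\<close>, far from \<open>\<Omega>\<close>. The lemma \<open>schur_test\<close> gives the bound
  \<open>2 m \<parallel>B\<parallel>\<^sup>2\<close> independently of the mollification, and \<open>approximate_identity\<close> permits the passage to the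
  limit, because piecewise polynomial fields are bounded and almost everywhere continuous. These are
  combined in \<open>helicity_bound\<close>.

  One point remains: the weak curl \<open>B\<close> is given by compactly supported test fields only, whereas the
  vanishing trace refers to some weak curl of \<open>A\<close>. That the two agree is \<open>weak_curl_unique\<close>,
  which rests on smooth bump functions.
\<close>

section \<open>Calculus of smooth functions\<close>

lemma partial_eqI: "(f has_derivative f') (at x) \<Longrightarrow> partial i f x = f' (axis i 1)"
  by (metis frechet_derivative_at partial_def)

lemma partial_const: "partial i (\<lambda>x. c) x = 0"
  by (rule partial_eqI[of _ "\<lambda>_. 0", THEN trans]) (auto intro!: derivative_eq_intros)

lemma partial_add:
  assumes "f differentiable (at x)" "g differentiable (at x)"
  shows "partial i (\<lambda>x. f x + g x) x = partial i f x + partial i g x"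
proof -
  have "((\<lambda>x. f x + g x) has_derivative
      (\<lambda>h. frechet_derivative f (at x) h + frechet_derivative g (at x) h)) (at x)"
    using assms by (intro has_derivative_add) (auto simp: frechet_derivative_works)
  from partial_eqI[OF this] show ?thesis by (simp add: partial_def)
qed

lemma partial_mult:
  assumes "f differentiable (at x)" "g differentiable (at x)"
  shows "partial i (\<lambda>x. f x * g x) x = f x * partial i g x + partial i f x * g x"
proof -
  have "((\<lambda>x. f x * g x) has_derivative
      (\<lambda>h. f x * frechet_derivative g (at x) h + frechet_derivative f (at x) h * g x)) (at x)"
    using assms by (intro has_derivative_mult) (auto simp: frechet_derivative_works)
  from partial_eqI[OF this] show ?thesis by (simp add: partial_def)
qed

lemma partial_chain:
  assumes "(G has_real_derivative D) (at (h x))" "h differentiable (at x)"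
  shows "(\<lambda>x. G (h x)) differentiable (at x)"
    and "partial i (\<lambda>x. G (h x)) x = D * partial i h x"
proof -
  have *: "((\<lambda>x. G (h x)) has_derivative (\<lambda>v. D * frechet_derivative h (at x) v)) (at x)"
    using has_derivative_compose[of h "frechet_derivative h (at x)" x UNIV G "(*) D"] assms
    by (auto simp: frechet_derivative_works has_field_derivative_def)
  show "(\<lambda>x. G (h x)) differentiable (at x)" using * differentiable_def by blast
  show "partial i (\<lambda>x. G (h x)) x = D * partial i h x"
    using partial_eqI[OF *] by (simp add: partial_def)
qed

lemma C_k_Suc_imp: "C_k (Suc k) f \<Longrightarrow> C_k k f"
proof (induction k arbitrary: f)
  case 0
  then show ?case
    by (auto intro!: continuous_at_imp_continuous_on differentiable_imp_continuous_within)
qed auto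

lemma C_k_const: "C_k k (\<lambda>x. c)"
proof (induction k arbitrary: c)
  case (Suc k)
  have "partial i (\<lambda>x. c) = (\<lambda>x. 0)" for i by (simp add: fun_eq_iff partial_const)
  with Suc show ?case by simp
qed simp

lemma C_k_add: "C_k k f \<Longrightarrow> C_k k g \<Longrightarrow> C_k k (\<lambda>x. f x + g x)"
proof (induction k arbitrary: f g)
  case (Suc k)
  then have "partial i (\<lambda>x. f x + g x) = (\<lambda>x. partial i f x + partial i g x)" for i
    by (auto simp: fun_eq_iff partial_add)
  with Suc show ?case by (auto intro: differentiable_add)
qed (auto intro: continuous_on_add)

lemma C_k_mult: "C_k k f \<Longrightarrow> C_k k g \<Longrightarrow> C_k k (\<lambda>x. f x * g x)"
proof (induction k arbitrary: f g)
  case (Suc k)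
  then have "partial i (\<lambda>x. f x * g x) = (\<lambda>x. f x * partial i g x + partial i f x * g x)" for i
    by (auto simp: fun_eq_iff partial_mult)
  moreover have "C_k k f" "C_k k g" using Suc.prems C_k_Suc_imp by blast+
  ultimately show ?case using Suc by (auto intro!: C_k_add intro: differentiable_mult)
qed (auto intro: continuous_on_mult)

lemma smooth_differentiable: "smooth f \<Longrightarrow> f differentiable (at x)"
  unfolding smooth_def by (metis C_k.simps(2))

lemma smooth_partial: "smooth f \<Longrightarrow> smooth (partial i f)"
  unfolding smooth_def by (metis C_k.simps(2))

lemma smooth_continuous: "smooth f \<Longrightarrow> continuous_on UNIV f"
  unfolding smooth_def by (metis C_k.simps(1))

lemma smooth_const [simp]: "smooth (\<lambda>x. c)"
  by (simp add: smooth_def C_k_const)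

lemma smooth_add: "smooth f \<Longrightarrow> smooth g \<Longrightarrow> smooth (\<lambda>x. f x + g x)"
  by (simp add: smooth_def C_k_add)

lemma smooth_mult: "smooth f \<Longrightarrow> smooth g \<Longrightarrow> smooth (\<lambda>x. f x * g x)"
  by (simp add: smooth_def C_k_mult)

lemma smooth_polynomial:
  assumes "real_polynomial_function f"
  shows "smooth f"
  using assms
proof induction
  case (linear f)
  then have "f differentiable (at x)" "partial i f x = f (axis i 1)" for i x
    by (auto simp: differentiable_def bounded_linear_imp_has_derivative
        intro!: partial_eqI exI[of _ f])
  moreover from this(2) have "partial i f = (\<lambda>x. f (axis i 1))" for i by auto
  moreover have "continuous_on UNIV f" using linear by (simp add: linear_continuous_on)
  ultimately have "C_k k f" for k by (cases k) (auto simp: C_k_const)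
  then show ?case by (simp add: smooth_def)
qed (auto intro: smooth_add smooth_mult)

text \<open>
  The sequence \<open>G\<close> lists a function on the line together with all its derivatives. The chain rule
  sends \<open>G m \<circ> h\<close> to \<open>G (Suc m) \<circ> h\<close> times a partial derivative of \<open>h\<close>, so the induction on
  the order of smoothness has to range over all members of the sequence at once.
\<close>

lemma smooth_compose:
  assumes G: "\<And>m t. (G m has_real_derivative G (Suc m) t) (at t)" and h: "smooth h"
  shows "smooth (\<lambda>x. G m (h x))"
proof -
  have "C_k k (\<lambda>x. G m (h x))" for k m
  proof (induction k arbitrary: m)
    case 0
    have "continuous_on UNIV (G m)"
      using G by (intro continuous_at_imp_continuous_on ballI DERIV_isCont)
    then show ?case using smooth_continuous[OF h] by (auto intro: continuous_on_compose2)
  next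
    case (Suc k)
    have "partial i (\<lambda>x. G m (h x)) = (\<lambda>x. G (Suc m) (h x) * partial i h x)" for i
      using partial_chain(2)[OF G smooth_differentiable[OF h]] by auto
    moreover have "C_k k (partial i h)" for i using smooth_partial[OF h] by (simp add: smooth_def)
    ultimately show ?case
      using Suc partial_chain(1)[OF G smooth_differentiable[OF h]] by (auto intro!: C_k_mult)
  qed
  then show ?thesis by (simp add: smooth_def)
qed

section \<open>Smooth bump functions\<close>

text \<open>
  The function \<open>exp (- 1 / t)\<close>, extended by zero to \<open>t \<le> 0\<close>, has derivatives of the form
  \<open>p (1 / t) * exp (- 1 / t)\<close>. The polynomials \<open>p\<close> follow from differentiating in \<open>u = 1 / t\<close>, where
  \<open>du / dt = - u\<^sup>2\<close>.
\<close>

primrec flat_poly :: "nat \<Rightarrow> real poly" where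
  "flat_poly 0 = 1"
| "flat_poly (Suc m) = monom 1 2 * (flat_poly m - pderiv (flat_poly m))"

definition flat :: "nat \<Rightarrow> real \<Rightarrow> real" where
  "flat m t = (if t > 0 then poly (flat_poly m) (1 / t) * exp (- (1 / t)) else 0)"

lemma poly_exp_tendsto_0:
  fixes p :: "real poly"
  shows "((\<lambda>u. poly p u * exp (- u)) \<longlongrightarrow> 0) at_top"
proof -
  have "((\<lambda>u. \<Sum>i\<le>degree p. coeff p i * (u ^ i / exp u)) \<longlongrightarrow> (\<Sum>i\<le>degree p. coeff p i * 0)) at_top"
    by (intro tendsto_intros tendsto_power_div_exp_0)
  then show ?thesis
    by (simp add: poly_altdef exp_minus sum_distrib_right divide_inverse mult.assoc)
qed

text \<open>
  At the origin the difference quotient from the right is \<open>u * p u * exp (- u)\<close> with \<open>u = 1 / h\<close>,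
  which tends to zero as \<open>u\<close> grows.
\<close>

lemma flat_deriv: "(flat m has_real_derivative flat (Suc m) t) (at t)"
proof -
  consider "t > 0" | "t < 0" | "t = 0" by linarith
  then show ?thesis
  proof cases
    case 1
    have "((\<lambda>t. poly (flat_poly m) (1 / t) * exp (- (1 / t))) has_real_derivative flat (Suc m) t) (at t)"
      using 1 by (auto intro!: derivative_eq_intros DERIV_chain2[OF poly_DERIV]
          simp: flat_def poly_monom field_simps power2_eq_square)
    then show ?thesis
      by (rule has_field_derivative_transform_within_open[of _ _ _ "{0<..}"])
        (use 1 in \<open>auto simp: flat_def\<close>)
  next
    case 2
    have "((\<lambda>t. 0) has_real_derivative flat (Suc m) t) (at t)"
      using 2 by (auto simp: flat_def)
    then show ?thesis
      by (rule has_field_derivative_transform_within_open[of _ _ _ "{..<0}"])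
        (use 2 in \<open>auto simp: flat_def\<close>)
  next
    case 3
    have "((\<lambda>h. flat m h / h) \<longlongrightarrow> 0) (at_right 0)"
    proof -
      have "((\<lambda>u. poly (pCons 0 (flat_poly m)) u * exp (- u)) \<longlongrightarrow> 0) at_top"
        by (rule poly_exp_tendsto_0)
      from filterlim_compose[OF this filterlim_inverse_at_top_right]
      have "((\<lambda>h. poly (pCons 0 (flat_poly m)) (inverse h) * exp (- inverse h)) \<longlongrightarrow> 0) (at_right 0)" .
      then show ?thesis
        by (rule Lim_transform_eventually)
          (auto simp: flat_def eventually_at_filter divide_inverse mult_ac)
    qed
    moreover have "((\<lambda>h. flat m h / h) \<longlongrightarrow> 0) (at_left 0)"
      by (rule Lim_transform_eventually[of "\<lambda>_. 0"]) (auto simp: flat_def eventually_at_filter)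
    ultimately have "((\<lambda>h. flat m h / h) \<longlongrightarrow> 0) (at 0)"
      by (simp add: filterlim_split_at)
    then show ?thesis using 3 by (simp add: flat_def DERIV_def)
  qed
qed

lemma smooth_bump_exists:
  fixes a :: "real^3"
  assumes "r > 0"
  obtains \<phi> :: "real^3 \<Rightarrow> real" where "smooth \<phi>" "\<And>x. x \<in> ball a r \<Longrightarrow> \<phi> x > 0"
    "\<And>x. x \<notin> ball a r \<Longrightarrow> \<phi> x = 0"
proof
  let ?h = "\<lambda>x. r\<^sup>2 - (\<Sum>i\<in>UNIV. (x $ i - a $ i)\<^sup>2)"
  have h: "?h x = r\<^sup>2 - (dist a x)\<^sup>2" for x
    by (simp add: dist_vec_def L2_set_def real_sqrt_pow2 sum_nonneg dist_real_def power2_commute)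
  have "real_polynomial_function ?h"
    by (intro real_polynomial_function_diff real_polynomial_function_sum real_polynomial_function_power
        real_polynomial_function.intros(1,2) bounded_linear_vec_nth) auto
  then show "smooth (\<lambda>x. flat 0 (?h x))"
    using smooth_compose[of flat, OF flat_deriv] smooth_polynomial by blast
  show "flat 0 (?h x) > 0" if "x \<in> ball a r" for x
    using that assms unfolding h by (auto simp: flat_def power_strict_mono)
  show "flat 0 (?h x) = 0" if "x \<notin> ball a r" for x
    using that assms unfolding h by (auto simp: flat_def not_less power_mono)
qed

section \<open>Square integrable fields and the fundamental lemma\<close>

lemma AE_lebesgue_on_iff:
  "S \<in> sets lebesgue \<Longrightarrow> (AE x in lebesgue_on S. P x) \<longleftrightarrow> (AE x in lebesgue. x \<in> S \<longrightarrow> P x)"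
  by (rule AE_restrict_space_iff) simp

lemma continuous_measurable_lebesgue_on:
  fixes f :: "'a::euclidean_space \<Rightarrow> 'b::euclidean_space"
  assumes "continuous_on UNIV f"
  shows "f \<in> borel_measurable (lebesgue_on S)"
proof -
  have "f \<in> borel_measurable borel" using assms by (rule borel_measurable_continuous_onI)
  then have "f \<in> borel_measurable lebesgue"
    by (simp add: measurable_completion)
  then show ?thesis by (rule measurable_restrict_space1)
qed

lemma integrable_L2_inner:
  fixes f g :: "real^3 \<Rightarrow> 'b::euclidean_space"
  assumes "f \<in> L2 \<Omega>" "g \<in> L2 \<Omega>"
  shows "integrable (lebesgue_on \<Omega>) (\<lambda>x. f x \<bullet> g x)"
proof (rule Bochner_Integration.integrable_bound)
  show "integrable (lebesgue_on \<Omega>) (\<lambda>x. (norm (f x))\<^sup>2 + (norm (g x))\<^sup>2)"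
    using assms by (simp add: L2_def)
  show "(\<lambda>x. f x \<bullet> g x) \<in> borel_measurable (lebesgue_on \<Omega>)"
    using assms by (auto simp: L2_def intro!: borel_measurable_inner)
  have "\<bar>f x \<bullet> g x\<bar> \<le> (norm (f x))\<^sup>2 + (norm (g x))\<^sup>2" for x
    using Cauchy_Schwarz_ineq2[of "f x" "g x"] sum_squares_bound[of "norm (f x)" "norm (g x)"]
      mult_nonneg_nonneg[of "norm (f x)" "norm (g x)"] by (simp del: mult_nonneg_nonneg) 
  then show "AE x in lebesgue_on \<Omega>. norm (f x \<bullet> g x) \<le> norm ((norm (f x))\<^sup>2 + (norm (g x))\<^sup>2)"
    by simp
qed

lemma bounded_continuous_L2:
  fixes f :: "real^3 \<Rightarrow> 'b::euclidean_space"
  assumes "bounded \<Omega>" "\<Omega> \<in> sets lebesgue" "continuous_on UNIV f"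
  shows "f \<in> L2 \<Omega>"
proof -
  interpret finite_measure "lebesgue_on \<Omega>" using assms finite_measure_lebesgue_on bounded_set_imp_lmeasurable by blast
  have m: "f \<in> borel_measurable (lebesgue_on \<Omega>)"
    using assms(3) by (rule continuous_measurable_lebesgue_on)
  have "compact (f ` closure \<Omega>)"
    using assms by (intro compact_continuous_image) (auto intro: continuous_on_subset)
  then obtain b where b: "\<And>x. x \<in> closure \<Omega> \<Longrightarrow> norm (f x) \<le> b"
    by (meson compact_imp_bounded bounded_iff imageI)
  have "norm (f x) \<le> b" if "x \<in> \<Omega>" for x using b closure_subset that by blast
  then have "norm ((norm (f x))\<^sup>2) \<le> b\<^sup>2" if "x \<in> \<Omega>" for x
    using that by (simp add: power_mono)
  then have "integrable (lebesgue_on \<Omega>) (\<lambda>x. (norm (f x))\<^sup>2)"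
    using m by (intro integrable_const_bound[of _ "b\<^sup>2"]) (auto simp: space_restrict_space intro!: AE_I2)
  with m show ?thesis by (simp add: L2_def)
qed

lemma L2_diff:
  fixes f g :: "real^3 \<Rightarrow> 'b::euclidean_space"
  assumes "f \<in> L2 \<Omega>" "g \<in> L2 \<Omega>"
  shows "(\<lambda>x. f x - g x) \<in> L2 \<Omega>"
proof -
  have "(norm (f x - g x))\<^sup>2 = (norm (f x))\<^sup>2 - 2 * (f x \<bullet> g x) + (norm (g x))\<^sup>2" for x
    by (simp add: power2_norm_eq_inner inner_diff inner_commute)
  then have "integrable (lebesgue_on \<Omega>) (\<lambda>x. (norm (f x - g x))\<^sup>2)"
    using assms integrable_L2_inner[OF assms] by (simp add: L2_def)
  then show ?thesis using assms by (simp add: L2_def borel_measurable_diff)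
qed

text \<open>
  If \<open>p a\<close> were nonzero, then \<open>p \<bullet> p a\<close> would be positive on a ball around \<open>a\<close>, and testing with a
  bump on this ball times the constant vector \<open>p a\<close> would give a positive integral.
\<close>

lemma fundamental_lemma:
  fixes f p :: "real^3 \<Rightarrow> real^3"
  assumes Om: "bounded \<Omega>" "\<Omega> \<in> sets lebesgue" and U: "open U" "U \<subseteq> \<Omega>" and f: "f \<in> L2 \<Omega>"
    and p: "continuous_on U p" "AE x in lebesgue_on U. f x = p x"
    and test: "\<And>\<Phi>. smooth_field \<Phi> \<Longrightarrow> compact_support_in \<Omega> \<Phi> \<Longrightarrow>
      (LINT x|lebesgue_on \<Omega>. f x \<bullet> \<Phi> x) = 0"
  shows "AE x in lebesgue_on U. f x = 0"
proof -
  have [measurable]: "U \<in> sets lebesgue" using U by (simp add: borel_open sets_completionI_sets)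
  have "p a = 0" if a: "a \<in> U" for a
  proof (rule ccontr)
    assume "p a \<noteq> 0"
    define V where "V = U \<inter> (\<lambda>x. p x \<bullet> p a) -` {0<..}"
    have "open V" unfolding V_def
      using U p by (intro continuous_open_preimage) (auto intro!: continuous_intros)
    moreover have "a \<in> V" using a \<open>p a \<noteq> 0\<close> by (simp add: V_def)
    ultimately obtain r where r: "r > 0" "cball a r \<subseteq> V" using open_contains_cball by blast
    obtain \<phi> :: "real^3 \<Rightarrow> real" where \<phi>: "smooth \<phi>" "\<And>x. x \<in> ball a r \<Longrightarrow> \<phi> x > 0"
      "\<And>x. x \<notin> ball a r \<Longrightarrow> \<phi> x = 0"
      using smooth_bump_exists[OF r(1)] by metis
    define \<Phi> where "\<Phi> = (\<lambda>x. \<phi> x *\<^sub>R p a)"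
    have "smooth_field \<Phi>"
      using \<phi>(1) by (auto simp: smooth_field_def \<Phi>_def intro!: smooth_mult)
    moreover have "compact_support_in \<Omega> \<Phi>" unfolding compact_support_in_def
    proof (intro exI conjI allI impI)
      show "cball a r \<subseteq> \<Omega>" using r U by (auto simp: V_def)
      show "\<Phi> x = 0" if "x \<notin> cball a r" for x using \<phi>(3)[of x] that by (auto simp: \<Phi>_def)
    qed auto
    ultimately have zero: "(LINT x|lebesgue_on \<Omega>. f x \<bullet> \<Phi> x) = 0" by (rule test)
    have "continuous_on UNIV \<Phi>"
      unfolding \<Phi>_def using smooth_continuous[OF \<phi>(1)] by (intro continuous_intros)
    then have int: "integrable (lebesgue_on \<Omega>) (\<lambda>x. f x \<bullet> \<Phi> x)"
      using Om f by (simp add: integrable_L2_inner bounded_continuous_L2)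
    have fp: "AE x in lebesgue. x \<in> U \<longrightarrow> f x = p x" using p(2) by (simp add: AE_lebesgue_on_iff)
    then have "AE x in lebesgue. x \<in> \<Omega> \<longrightarrow> 0 \<le> f x \<bullet> \<Phi> x"
    proof eventually_elim
      case (elim x)
      show ?case
      proof (cases "x \<in> ball a r")
        case True
        then have "x \<in> V" using r ball_subset_cball by blast
        then show ?thesis using elim \<phi>(2)[OF True] by (auto simp: V_def \<Phi>_def)
      qed (simp add: \<Phi>_def \<phi>(3))
    qed
    then have "AE x in lebesgue_on \<Omega>. 0 \<le> f x \<bullet> \<Phi> x" using Om by (simp add: AE_lebesgue_on_iff)
    then have "AE x in lebesgue_on \<Omega>. f x \<bullet> \<Phi> x = 0"
      using integral_nonneg_eq_0_iff_AE[OF int] zero by blast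
    then have "AE x in lebesgue. x \<in> \<Omega> \<longrightarrow> f x \<bullet> \<Phi> x = 0" using Om by (simp add: AE_lebesgue_on_iff)
    with fp have "AE x in lebesgue. x \<notin> ball a r"
    proof eventually_elim
      case (elim x)
      show ?case
      proof
        assume x: "x \<in> ball a r"
        then have "x \<in> V" using r ball_subset_cball by blast
        with elim \<phi>(2)[OF x] U show False by (auto simp: V_def \<Phi>_def)
      qed
    qed
    then have "negligible (ball a r)"
      using AE_iff_null_sets[of "ball a r" lebesgue] by (simp add: negligible_iff_null_sets)
    then show False using r open_not_negligible[of "ball a r"] by simp
  qed
  then have "AE x in lebesgue_on U. p x = 0" by (auto simp: space_restrict_space intro!: AE_I2)
  with p(2) show ?thesis by eventually_elim simp
qed

section \<open>The Landau kernel\<close>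

text \<open>
  The Landau kernel is an approximate identity on \<open>[- R, R]\<close> made of polynomials. On a bounded
  domain the traces are tested against fields that are smooth on the whole space without any support
  condition, so mollifying with a polynomial is permitted. It is also convenient: a polynomial in
  \<open>x - y\<close> is a finite sum of products \<open>p x * q y\<close>, hence convolutions with it are visibly smooth.
\<close>

definition landau_mass :: "real \<Rightarrow> nat \<Rightarrow> real" where
  "landau_mass R n = integral {-R..R} (\<lambda>s. (R\<^sup>2 - s\<^sup>2) ^ n)"

definition landau :: "real \<Rightarrow> nat \<Rightarrow> real \<Rightarrow> real" where
  "landau R n s = (R\<^sup>2 - s\<^sup>2) ^ n / landau_mass R n"

text \<open>
  Bounding the integral from below by its part over \<open>[- \<delta> / 2, \<delta> / 2]\<close> produces the base
  \<open>R\<^sup>2 - (\<delta> / 2)\<^sup>2\<close>, which is strictly larger than the values of \<open>R\<^sup>2 - s\<^sup>2\<close> for \<open>\<bar>s\<bar> \<ge> \<delta>\<close>. This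
  gap makes the normalised kernel decay geometrically away from the origin.
\<close>

lemma landau_mass_lower:
  assumes "0 < \<delta>" "\<delta> \<le> R"
  shows "\<delta> * (R\<^sup>2 - (\<delta> / 2)\<^sup>2) ^ n \<le> landau_mass R n"
proof -
  have i: "(\<lambda>s. (R\<^sup>2 - s\<^sup>2) ^ n) integrable_on {a..b}" for a b :: real
    by (intro integrable_continuous_real continuous_intros)
  have "\<delta> * (R\<^sup>2 - (\<delta> / 2)\<^sup>2) ^ n = integral {-\<delta>/2..\<delta>/2} (\<lambda>s. (R\<^sup>2 - (\<delta> / 2)\<^sup>2) ^ n)"
    using assms by simp
  also have "\<dots> \<le> integral {-\<delta>/2..\<delta>/2} (\<lambda>s. (R\<^sup>2 - s\<^sup>2) ^ n)"
  proof (intro integral_le i power_mono)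
    fix s assume "s \<in> {-\<delta>/2..\<delta>/2}"
    then have "\<bar>s\<bar> \<le> \<bar>\<delta>/2\<bar>" by auto
    then show "R\<^sup>2 - (\<delta> / 2)\<^sup>2 \<le> R\<^sup>2 - s\<^sup>2" by (simp only: abs_le_square_iff diff_left_mono)
    have "(\<delta>/2)\<^sup>2 \<le> R\<^sup>2" using assms by (intro power_mono) auto
    then show "0 \<le> R\<^sup>2 - (\<delta> / 2)\<^sup>2" by simp
  qed auto
  also have "\<dots> \<le> landau_mass R n" unfolding landau_mass_def
  proof (intro integral_subset_le i ballI)
    fix s assume "s \<in> {-R..R}"
    then have "s\<^sup>2 \<le> R\<^sup>2" using assms by (intro abs_le_square_iff[THEN iffD1]) auto
    then show "0 \<le> (R\<^sup>2 - s\<^sup>2) ^ n" by simp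
  qed (use assms in auto)
  finally show ?thesis .
qed

lemma landau_mass_pos: "R > 0 \<Longrightarrow> landau_mass R n > 0"
proof -
  assume "R > 0"
  then have "(R / 2)\<^sup>2 < R\<^sup>2" by (intro power_strict_mono) auto
  then have "0 < R * (R\<^sup>2 - (R / 2)\<^sup>2) ^ n" using \<open>R > 0\<close> by simp
  with landau_mass_lower[of R R n] \<open>R > 0\<close> show ?thesis by simp
qed

lemma polynomial_landau: "real_polynomial_function (landau R n)"
  unfolding landau_def
  by (intro real_polynomial_function_divide real_polynomial_function_power
      real_polynomial_function_diff real_polynomial_function.intros(1,2) bounded_linear_ident)

lemma continuous_landau: "continuous_on S (landau R n)"
  using polynomial_landau continuous_on_polymonial_function real_polynomial_function_eq by blast

lemma landau_nonneg:
  assumes "R > 0" "\<bar>s\<bar> \<le> R"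
  shows "0 \<le> landau R n s"
proof -
  have "s\<^sup>2 \<le> R\<^sup>2" using assms by (intro abs_le_square_iff[THEN iffD1]) auto
  then show ?thesis using landau_mass_pos[OF assms(1), of n] by (simp add: landau_def)
qed

lemma landau_even: "landau R n (- s) = landau R n s"
  by (simp add: landau_def)

lemma integral_landau: "R > 0 \<Longrightarrow> integral {-R..R} (landau R n) = 1"
  using landau_mass_pos[of R n] by (simp add: landau_def[abs_def] landau_mass_def)

lemma landau_tail:
  assumes R: "R > 0" and "0 < \<delta>" "\<delta> \<le> R" "\<epsilon> > 0"
  shows "eventually (\<lambda>n. \<forall>s. \<delta> \<le> \<bar>s\<bar> \<and> \<bar>s\<bar> \<le> R \<longrightarrow> landau R n s \<le> \<epsilon>) sequentially"
proof -
  let ?A = "R\<^sup>2 - \<delta>\<^sup>2" and ?B = "R\<^sup>2 - (\<delta> / 2)\<^sup>2"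
  have "\<delta>\<^sup>2 \<le> R\<^sup>2" using assms by (intro power_mono) auto
  moreover have "(\<delta> / 2)\<^sup>2 < \<delta>\<^sup>2" using assms by (intro power_strict_mono) auto
  ultimately have AB: "0 \<le> ?A" "?A < ?B" "0 < ?B" by linarith+
  have "(\<lambda>n. (?A / ?B) ^ n / \<delta>) \<longlonglongrightarrow> 0 / \<delta>"
    using AB assms by (intro tendsto_intros LIMSEQ_realpow_zero) auto
  then have "eventually (\<lambda>n. (?A / ?B) ^ n / \<delta> < \<epsilon>) sequentially"
    using \<open>\<epsilon> > 0\<close> by (intro order_tendstoD) auto
  then show ?thesis
  proof eventually_elim
    case (elim n)
    show ?case
    proof (intro allI impI, elim conjE)
      fix s assume s: "\<delta> \<le> \<bar>s\<bar>" "\<bar>s\<bar> \<le> R"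
      have "\<delta>\<^sup>2 \<le> s\<^sup>2" "s\<^sup>2 \<le> R\<^sup>2" using s assms by (auto simp: abs_le_square_iff[symmetric])
      then have "landau R n s \<le> ?A ^ n / landau_mass R n"
        unfolding landau_def using landau_mass_pos[OF R, of n]
        by (intro divide_right_mono power_mono) auto
      also have "\<dots> \<le> ?A ^ n / (\<delta> * ?B ^ n)"
        using landau_mass_lower[of \<delta> R n] assms AB landau_mass_pos[OF R, of n]
        by (intro divide_left_mono) auto
      also have "\<dots> = (?A / ?B) ^ n / \<delta>" by (simp add: power_divide)
      finally show "landau R n s \<le> \<epsilon>" using elim by simp
    qed
  qed
qed

lemma landau_concentrates:
  assumes R: "R > 0" and d: "0 < \<delta>" "\<delta> \<le> R"
  shows "(\<lambda>n. integral {-\<delta>..\<delta>} (landau R n)) \<longlonglongrightarrow> 1"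
proof (rule LIMSEQ_I)
  fix e :: real assume "e > 0"
  have i: "landau R n integrable_on {a..b}" for n a b
    by (intro integrable_continuous_real continuous_landau)
  have "eventually (\<lambda>n. \<forall>s. \<delta> \<le> \<bar>s\<bar> \<and> \<bar>s\<bar> \<le> R \<longrightarrow> landau R n s \<le> e / (4 * R)) sequentially"
    using assms \<open>e > 0\<close> by (intro landau_tail) auto
  then have "eventually (\<lambda>n. norm (integral {-\<delta>..\<delta>} (landau R n) - 1) < e) sequentially"
  proof eventually_elim
    case (elim n)
    have 1: "integral {-R..-\<delta>} (landau R n) + integral {-\<delta>..\<delta>} (landau R n)
        + integral {\<delta>..R} (landau R n) = 1"
      using integral_landau[OF R, of n] d
        Henstock_Kurzweil_Integration.integral_combine[OF _ _ i, of "-R" "-\<delta>" R n]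
        Henstock_Kurzweil_Integration.integral_combine[OF _ _ i, of "-\<delta>" \<delta> R n]
      by simp
    have "integral {-R..-\<delta>} (landau R n) \<le> integral {-R..-\<delta>} (\<lambda>_. e / (4 * R))"
      using elim d by (intro integral_le i) auto
    moreover have "integral {\<delta>..R} (landau R n) \<le> integral {\<delta>..R} (\<lambda>_. e / (4 * R))"
      using elim d by (intro integral_le i) auto
    moreover have "0 \<le> integral {-R..-\<delta>} (landau R n)" "0 \<le> integral {\<delta>..R} (landau R n)"
      using landau_nonneg[OF R] d by (auto intro!: integral_nonneg i)
    moreover have "(R - \<delta>) * (e / (4 * R)) \<le> e / 4"
      using R d \<open>e > 0\<close> by (simp add: field_simps)
    ultimately show ?case using 1 d \<open>e > 0\<close> by (simp add: abs_if)
  qed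
  then show "\<exists>no. \<forall>n\<ge>no. norm (integral {-\<delta>..\<delta>} (landau R n) - 1) < e"
    by (simp add: eventually_sequentially)
qed

lemma polynomial_antiderivative:
  assumes "real_polynomial_function f"
  obtains F where "real_polynomial_function F" "\<And>x. (F has_real_derivative f x) (at x)"
proof -
  obtain a n where f: "f = (\<lambda>x. \<Sum>i\<le>n. a i * x ^ i)"
    using assms real_polynomial_function_iff_sum by auto
  show thesis
  proof
    show "real_polynomial_function (\<lambda>x. \<Sum>i\<le>n. a i * (x ^ Suc i / real (Suc i)))"
      by (intro real_polynomial_function_sum real_polynomial_function.intros(1,2,4)
          real_polynomial_function_divide real_polynomial_function_power bounded_linear_ident) auto
    show "((\<lambda>x. \<Sum>i\<le>n. a i * (x ^ Suc i / real (Suc i))) has_real_derivative f x) (at x)" for x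
      unfolding f by (auto intro!: derivative_eq_intros sum.cong simp del: power_Suc of_nat_Suc)
  qed
qed

section \<open>Integrals of products over boxes\<close>

lemma UNIV_3_prod: "(\<Prod>i\<in>(UNIV::3 set). f i) = f 1 * f 2 * f 3"
  unfolding UNIV_3 by (simp add: mult.assoc)

lemma prod_Basis_axis:
  "(\<Prod>b\<in>(Basis::(real^'n) set). h b) = (\<Prod>i\<in>UNIV. h (axis i 1))"
proof -
  have "(Basis::(real^'n) set) = range (\<lambda>i. axis i 1)" by (auto simp: Basis_vec_def)
  moreover have "inj (\<lambda>i::'n. axis i (1::real))" by (auto simp: inj_on_def axis_eq_axis)
  ultimately show ?thesis using prod.reindex[of "\<lambda>i::'n. axis i (1::real)" UNIV h] by (simp only: o_def)
qed

text \<open>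
  Lebesgue measure on \<open>\<real>\<^sup>3\<close> is a product measure, so the integral of a product of functions of single
  coordinates over a box factorises. Nonnegativity on the box allows the computation to be done with
  the nonnegative integral, where Tonelli needs no integrability.
\<close>

lemma integral_cbox_prod:
  fixes f :: "3 \<Rightarrow> real \<Rightarrow> real" and l u :: "real^3"
  assumes c: "\<And>i. continuous_on UNIV (f i)" and nn: "\<And>i t. l $ i \<le> t \<Longrightarrow> t \<le> u $ i \<Longrightarrow> 0 \<le> f i t"
  shows "(LINT y|lebesgue_on (cbox l u). (\<Prod>i\<in>UNIV. f i (y $ i))) = (\<Prod>i\<in>UNIV. integral {l$i..u$i} (f i))"
proof -
  define g where "g i t = indicator {l$i..u$i} t * f i t" for i t
  have fm[measurable]: "f i \<in> borel_measurable borel" for i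
    using c by (rule borel_measurable_continuous_onI)
  have gm[measurable]: "g i \<in> borel_measurable borel" for i unfolding g_def by measurable
  have gn: "0 \<le> g i t" for i t using nn by (auto simp: g_def indicator_def)
  have I: "(f i has_integral integral {l$i..u$i} (f i)) {l$i..u$i}" for i
    using c by (intro integrable_integral integrable_continuous_real) (auto intro: continuous_on_subset)
  have I0: "0 \<le> integral {l$i..u$i} (f i)" for i
    using I nn by (intro integral_nonneg) auto
  have g1: "(\<integral>\<^sup>+t. ennreal (g i t) \<partial>lborel) = ennreal (integral {l$i..u$i} (f i))" for i
  proof -
    have "(\<integral>\<^sup>+t. indicator {l$i..u$i} t * f i t \<partial>lborel) = ennreal (integral {l$i..u$i} (f i))"
      by (rule nn_integral_has_integral_lebesgue) (use nn I in auto)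
    then show ?thesis by (simp add: g_def)
  qed
  have ind: "indicator (cbox l u) y * (\<Prod>i\<in>UNIV. f i (y $ i)) = (\<Prod>i\<in>UNIV. g i (y $ i))" for y
    unfolding g_def prod.distrib mem_box_cart indicator_def by (auto simp: mem_box_cart)
  have "(LINT y|lebesgue_on (cbox l u). (\<Prod>i\<in>UNIV. f i (y $ i)))
      = (LINT y|lebesgue. (\<Prod>i\<in>UNIV. g i (y $ i)))"
    by (subst integral_restrict_space) (auto simp: ind)
  also have "\<dots> = (LINT y|lborel. (\<Prod>i\<in>UNIV. g i (y $ i)))"
    by (rule integral_completion) measurable
  also have "\<dots> = enn2real (\<integral>\<^sup>+y. ennreal (\<Prod>i\<in>UNIV. g i (y $ i)) \<partial>lborel)"
    by (rule integral_eq_nn_integral) (auto intro!: prod_nonneg gn)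
  also have "(\<integral>\<^sup>+y. ennreal (\<Prod>i\<in>UNIV. g i (y $ i)) \<partial>lborel)
      = (\<integral>\<^sup>+y. (\<Prod>b\<in>(Basis::(real^3) set). ennreal (g (axis_index b) (y \<bullet> b))) \<partial>lborel)"
    by (simp only: prod_Basis_axis axis_index_axis inner_axis prod_ennreal[OF gn] inner_real_def mult_1_right)
  also have "\<dots> = (\<Prod>b\<in>(Basis::(real^3) set). (\<integral>\<^sup>+t. ennreal (g (axis_index b) t) \<partial>lborel))"
    by (rule nn_integral_lborel_prod) auto
  also have "\<dots> = ennreal (\<Prod>i\<in>UNIV. integral {l$i..u$i} (f i))"
    by (simp only: prod_Basis_axis axis_index_axis g1 prod_ennreal[OF I0])
  finally show ?thesis using I0 by (simp add: prod_nonneg)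
qed

section \<open>Separable kernels\<close>

text \<open>
  Kernels that are finite sums of products of a smooth function of \<open>x\<close> and a continuous function of
  \<open>y\<close>. For these, differentiation under the integral sign and the exchange of two integrations are
  mere linearity of the integral, and both follow by induction over the number of summands.
\<close>

inductive separable :: "(real^3 \<Rightarrow> real^3 \<Rightarrow> real) \<Rightarrow> bool" where
  separable_product: "smooth p \<Longrightarrow> continuous_on UNIV q \<Longrightarrow> separable (\<lambda>x y. p x * q y)"
| separable_add: "separable k \<Longrightarrow> separable l \<Longrightarrow> separable (\<lambda>x y. k x y + l x y)"

lemma separable_mult:
  assumes "separable k" "separable l"
  shows "separable (\<lambda>x y. k x y * l x y)"
  using assms
proof (induction arbitrary: l)
  case (separable_product p q)
  from separable_product(3) show ?case
  proof induction
    case (separable_product p' q')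
    have "separable (\<lambda>x y. (p x * p' x) * (q y * q' y))"
      using \<open>smooth p\<close> \<open>continuous_on UNIV q\<close> separable_product
      by (intro separable.intros smooth_mult continuous_on_mult)
    then show ?case by (simp add: mult_ac)
  next
    case (separable_add k l)
    then show ?case using separable.separable_add by (simp add: distrib_left)
  qed
next
  case (separable_add k k')
  then show ?case using separable.separable_add by (simp add: distrib_right)
qed

lemma separable_fst: "smooth p \<Longrightarrow> separable (\<lambda>x y. p x)"
  using separable_product[of p "\<lambda>_. 1"] by simp

lemma separable_snd: "continuous_on UNIV q \<Longrightarrow> separable (\<lambda>x y. q y)"
  using separable_product[of "\<lambda>_. 1" q] by simp

lemma separable_polynomial_diff:
  assumes "real_polynomial_function f"
  shows "separable (\<lambda>x y. f (x $ i - y $ i))"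
  using assms
proof induction
  case (linear f)
  have l: "bounded_linear (\<lambda>x::real^3. f (x $ i))"
    using linear bounded_linear_vec_nth by (rule bounded_linear_compose)
  have "f (x $ i - y $ i) = f (x $ i) + - f (y $ i)" for x y :: "real^3"
    using linear_diff[OF bounded_linear.linear[OF linear]] by simp
  moreover have "separable (\<lambda>x y. f (x $ i) + - f (y $ i))"
    using l by (intro separable_add separable_fst separable_snd smooth_polynomial
        real_polynomial_function.intros(1) continuous_on_minus linear_continuous_on)
  ultimately show ?case by presburger
next
  case (const c)
  show ?case by (rule separable_fst) simp
qed (auto intro: separable_add separable_mult)

lemma integrable_mult_continuous:
  fixes q g :: "real^3 \<Rightarrow> real"
  assumes "bounded \<Omega>" "continuous_on UNIV q" "integrable (lebesgue_on \<Omega>) g"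
  shows "integrable (lebesgue_on \<Omega>) (\<lambda>y. q y * g y)"
proof -
  have "compact (q ` closure \<Omega>)"
    using assms by (intro compact_continuous_image) (auto intro: continuous_on_subset)
  then obtain b where b: "\<And>x. x \<in> closure \<Omega> \<Longrightarrow> \<bar>q x\<bar> \<le> b"
    by (metis (no_types, opaque_lifting) compact_imp_bounded bounded_iff imageI real_norm_def)
  have "\<bar>q y\<bar> \<le> \<bar>b\<bar>" if "y \<in> \<Omega>" for y
    using b[of y] closure_subset[of \<Omega>] that by auto
  then have "norm (q y * g y) \<le> norm (b * g y)" if "y \<in> \<Omega>" for y
    using that unfolding real_norm_def abs_mult by (blast intro: mult_right_mono abs_ge_zero)
  then have le: "AE y in lebesgue_on \<Omega>. norm (q y * g y) \<le> norm (b * g y)"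
    by (auto simp: space_restrict_space intro!: AE_I2)
  have "q \<in> borel_measurable (lebesgue_on \<Omega>)"
    using assms by (intro continuous_measurable_lebesgue_on)
  then have "(\<lambda>y. q y * g y) \<in> borel_measurable (lebesgue_on \<Omega>)"
    using borel_measurable_integrable[OF assms(3)] by (rule borel_measurable_times)
  moreover have "integrable (lebesgue_on \<Omega>) (\<lambda>y. b * g y)"
    using assms by (intro integrable_mult_right)
  ultimately show ?thesis using le Bochner_Integration.integrable_bound by blast
qed

lemma separable_integrable:
  assumes k: "separable k" and Om: "bounded \<Omega>" "integrable (lebesgue_on \<Omega>) g"
  shows "integrable (lebesgue_on \<Omega>) (\<lambda>y. k x y * g y)"
  using k
proof induction
  case (separable_product p q)
  then have "integrable (lebesgue_on \<Omega>) (\<lambda>y. p x * (q y * g y))"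
    using integrable_mult_continuous Om by (intro integrable_mult_right)
  then show ?case by (simp add: mult.assoc)
qed (simp add: distrib_right)

lemma separable_integral_smooth:
  assumes k: "separable k" and Om: "bounded \<Omega>" "integrable (lebesgue_on \<Omega>) g"
  shows "smooth (\<lambda>x. LINT y|lebesgue_on \<Omega>. k x y * g y)"
  using k
proof induction
  case (separable_product p q)
  then have "smooth (\<lambda>x. p x * (LINT y|lebesgue_on \<Omega>. q y * g y))"
    by (intro smooth_mult) auto
  then show ?case by (simp add: mult.assoc)
next
  case (separable_add k l)
  then show ?case
    using separable_integrable[OF _ Om] by (simp add: distrib_right smooth_add)
qed

lemma separable_differentiable: "separable k \<Longrightarrow> (\<lambda>x. k x y) differentiable (at x)"
proof (induction rule: separable.induct)
  case (separable_product p q)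
  then show ?case by (intro differentiable_mult smooth_differentiable) auto
qed (rule differentiable_add)

lemma separable_integral_partial:
  assumes k: "separable k" and Om: "bounded \<Omega>" "integrable (lebesgue_on \<Omega>) g"
  shows "integrable (lebesgue_on \<Omega>) (\<lambda>y. partial i (\<lambda>x. k x y) x * g y)" (is "?I k")
    and "partial i (\<lambda>x. LINT y|lebesgue_on \<Omega>. k x y * g y) x =
      (LINT y|lebesgue_on \<Omega>. partial i (\<lambda>x. k x y) x * g y)" (is "?E k")
proof -
  have "?I k \<and> ?E k"
    using k
  proof induction
    case (separable_product p q)
    have 1: "partial i (\<lambda>x. p x * c) x = partial i p x * c" for c
      using smooth_differentiable[OF separable_product(1)]
      by (subst partial_mult) (auto simp: partial_const)
    have "integrable (lebesgue_on \<Omega>) (\<lambda>y. partial i p x * (q y * g y))"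
      using integrable_mult_continuous Om separable_product by (intro integrable_mult_right)
    then show ?case by (simp add: 1 mult.assoc)
  next
    case (separable_add k l)
    have 1: "partial i (\<lambda>x. k x y + l x y) x = partial i (\<lambda>x. k x y) x + partial i (\<lambda>x. l x y) x" for y
      using separable_add separable_differentiable by (intro partial_add)
    have "partial i (\<lambda>x. (LINT y|lebesgue_on \<Omega>. k x y * g y) + (LINT y|lebesgue_on \<Omega>. l x y * g y)) x
      = partial i (\<lambda>x. LINT y|lebesgue_on \<Omega>. k x y * g y) x
        + partial i (\<lambda>x. LINT y|lebesgue_on \<Omega>. l x y * g y) x"
      using separable_add Om
      by (intro partial_add smooth_differentiable separable_integral_smooth)
    then show ?case
      using separable_add separable_integrable[OF _ Om] by (simp add: 1 distrib_right)
  qed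
  then show "?I k" "?E k" by auto
qed

lemma integrable_continuous_bounded:
  fixes f :: "real^3 \<Rightarrow> real"
  assumes "bounded \<Omega>" "\<Omega> \<in> sets lebesgue" "continuous_on UNIV f"
  shows "integrable (lebesgue_on \<Omega>) f"
proof -
  have "integrable (lebesgue_on \<Omega>) (\<lambda>_. 1::real)"
    using assms finite_measure.integrable_const[OF finite_measure_lebesgue_on]
      bounded_set_imp_lmeasurable by blast
  from integrable_mult_continuous[OF assms(1,3) this] show ?thesis by simp
qed

lemma separable_integral_swap:
  assumes k: "separable k" and Om: "bounded \<Omega>" "\<Omega> \<in> sets lebesgue" "integrable (lebesgue_on \<Omega>) g"
  shows "(LINT x|lebesgue_on \<Omega>. LINT y|lebesgue_on \<Omega>. k x y * g y) =
      (LINT y|lebesgue_on \<Omega>. (LINT x|lebesgue_on \<Omega>. k x y) * g y)" (is "?E k")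
    and "integrable (lebesgue_on \<Omega>) (\<lambda>y. (LINT x|lebesgue_on \<Omega>. k x y) * g y)" (is "?I k")
proof -
  have int: "integrable (lebesgue_on \<Omega>) (\<lambda>x. LINT y|lebesgue_on \<Omega>. k x y * g y)" if "separable k" for k
    by (rule integrable_continuous_bounded[OF Om(1,2)
          smooth_continuous[OF separable_integral_smooth[OF that Om(1,3)]]])
  have sint: "integrable (lebesgue_on \<Omega>) (\<lambda>x. k x y)" if "separable k" for k y
    using that
  proof induction
    case (separable_product p q)
    then show ?case using Om by (intro integrable_mult_left integrable_continuous_bounded smooth_continuous)
  qed simp
  have "?I k \<and> ?E k"
    using k
  proof induction
    case (separable_product p q)
    have "integrable (lebesgue_on \<Omega>) (\<lambda>y. (LINT x|lebesgue_on \<Omega>. p x) * (q y * g y))"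
      using integrable_mult_continuous Om separable_product by (intro integrable_mult_right)
    then show ?case by (simp add: mult.assoc)
  next
    case (separable_add k l)
    then show ?case
      using separable_integrable[OF _ Om(1,3)] int sint by (simp add: distrib_right)
  qed
  then show "?E k" "?I k" by auto
qed

text \<open>
  The Schur test for the quadratic form of a nonnegative kernel. The bound \<open>(N x + N y) / 2\<close> splits the
  double integral into two halves: in the first the integration over \<open>y\<close> is a row sum, in the second
  the order of integration is exchanged and the integration over \<open>x\<close> is a column sum.
\<close>

lemma schur_test:
  fixes u :: "real^3 \<Rightarrow> real" and N :: "real^3 \<Rightarrow> real"
  assumes k: "separable k" and Om: "bounded \<Omega>" "\<Omega> \<in> sets lebesgue" "integrable (lebesgue_on \<Omega>) N"
    and nonneg: "\<And>x y. x \<in> \<Omega> \<Longrightarrow> y \<in> \<Omega> \<Longrightarrow> 0 \<le> k x y" "\<And>x. x \<in> \<Omega> \<Longrightarrow> 0 \<le> N x"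
    and row: "\<And>x. x \<in> \<Omega> \<Longrightarrow> (LINT y|lebesgue_on \<Omega>. k x y) \<le> L"
    and col: "\<And>y. y \<in> \<Omega> \<Longrightarrow> (LINT x|lebesgue_on \<Omega>. k x y) \<le> L"
    and b: "\<And>x y. x \<in> \<Omega> \<Longrightarrow> y \<in> \<Omega> \<Longrightarrow> b x y \<le> (N x + N y) / 2"
    and bi: "\<And>x. x \<in> \<Omega> \<Longrightarrow> integrable (lebesgue_on \<Omega>) (\<lambda>y. k x y * b x y)"
      "integrable (lebesgue_on \<Omega>) (\<lambda>x. LINT y|lebesgue_on \<Omega>. k x y * b x y)"
  shows "(LINT x|lebesgue_on \<Omega>. LINT y|lebesgue_on \<Omega>. k x y * b x y) \<le> L * (LINT x|lebesgue_on \<Omega>. N x)"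
proof -
  let ?M = "lebesgue_on \<Omega>"
  have one: "integrable ?M (\<lambda>_. 1::real)" using Om integrable_continuous_bounded by auto
  have kint: "integrable ?M (\<lambda>y. k x y)" for x
    using separable_integrable[OF k Om(1) one] by simp
  have kN: "integrable ?M (\<lambda>y. k x y * N y)" for x
    using separable_integrable[OF k Om(1,3)] .
  have kNi: "integrable ?M (\<lambda>x. LINT y|?M. k x y * N y)"
    by (rule integrable_continuous_bounded[OF Om(1,2)
          smooth_continuous[OF separable_integral_smooth[OF k Om(1,3)]]])
  have "(LINT y|?M. k x y * b x y) \<le> L * N x / 2 + (LINT y|?M. k x y * N y) / 2" if x: "x \<in> \<Omega>" for x
  proof -
    have "(LINT y|?M. k x y * b x y) \<le> (LINT y|?M. k x y * (N x / 2) + k x y * N y / 2)"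
    proof (rule integral_mono)
      show "k x y * b x y \<le> k x y * (N x / 2) + k x y * N y / 2" if "y \<in> space ?M" for y
        using mult_left_mono[OF b nonneg(1), of x y x y] x that
        by (simp add: space_restrict_space field_simps)
    qed (use bi x kint kN in auto)
    also have "\<dots> = (LINT y|?M. k x y) * N x / 2 + (LINT y|?M. k x y * N y) / 2"
      using kint kN by simp
    also have "(LINT y|?M. k x y) * N x \<le> L * N x"
      using row nonneg x by (intro mult_right_mono) auto
    finally show ?thesis by simp
  qed
  then have "(LINT x|?M. LINT y|?M. k x y * b x y) \<le> (LINT x|?M. L * N x / 2 + (LINT y|?M. k x y * N y) / 2)"
    using bi Om kNi by (intro integral_mono) (auto simp: space_restrict_space)
  also have "\<dots> = L * (LINT x|?M. N x) / 2 + (LINT x|?M. LINT y|?M. k x y * N y) / 2"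
    using Om kNi by simp
  also have "(LINT x|?M. LINT y|?M. k x y * N y) = (LINT y|?M. (LINT x|?M. k x y) * N y)"
    using k Om by (rule separable_integral_swap)
  also have "\<dots> \<le> (LINT y|?M. L * N y)"
  proof (rule integral_mono)
    show "(LINT x|?M. k x y) * N y \<le> L * N y" if "y \<in> space ?M" for y
      using that col nonneg by (intro mult_right_mono) (auto simp: space_restrict_space)
  qed (use separable_integral_swap(2)[OF k Om] Om in auto)
  finally show ?thesis by simp
qed

section \<open>An explicit vector potential\<close>

lemma partial_component_product:
  fixes x :: "real^3"
  assumes "(f has_real_derivative f') (at (x $ 1))" "(g has_real_derivative g') (at (x $ 2))"
    "(h has_real_derivative h') (at (x $ 3))"
  shows "partial 1 (\<lambda>x. f (x $ 1) * g (x $ 2) * h (x $ 3)) x = f' * g (x $ 2) * h (x $ 3)"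
    and "partial 2 (\<lambda>x. f (x $ 1) * g (x $ 2) * h (x $ 3)) x = f (x $ 1) * g' * h (x $ 3)"
    and "partial 3 (\<lambda>x. f (x $ 1) * g (x $ 2) * h (x $ 3)) x = f (x $ 1) * g (x $ 2) * h'"
proof -
  have c: "((\<lambda>x. F (x $ j)) has_derivative (\<lambda>v. D * v $ j)) (at x)"
    if "(F has_real_derivative D) (at (x $ j))" for F D j
    using has_derivative_compose[of "\<lambda>x. x $ j" "\<lambda>v. v $ j" x UNIV F "(*) D"] that
    by (simp add: has_field_derivative_def bounded_linear_imp_has_derivative bounded_linear_vec_nth)
  note partial_eqI[OF has_derivative_mult[OF has_derivative_mult[OF c[OF assms(1)] c[OF assms(2)]] c[OF assms(3)]]]
  note this[of 1] this[of 2] this[of 3]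
  then show "partial 1 (\<lambda>x. f (x $ 1) * g (x $ 2) * h (x $ 3)) x = f' * g (x $ 2) * h (x $ 3)"
    and "partial 2 (\<lambda>x. f (x $ 1) * g (x $ 2) * h (x $ 3)) x = f (x $ 1) * g' * h (x $ 3)"
    and "partial 3 (\<lambda>x. f (x $ 1) * g (x $ 2) * h (x $ 3)) x = f (x $ 1) * g (x $ 2) * h'"
    by (simp_all add: axis_def)
qed

lemma smooth_component_product:
  assumes "real_polynomial_function f" "real_polynomial_function g" "real_polynomial_function h"
  shows "smooth (\<lambda>x. f (x $ 1) * g (x $ 2) * h (x $ 3))"
proof -
  have "real_polynomial_function (\<lambda>x::real^3. F (x $ j))" if "real_polynomial_function F" for F j
    using real_polynomial_function_compose[of "\<lambda>x::real^3. x $ j" F] that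
      polynomial_function_bounded_linear[OF bounded_linear_vec_nth[of j]] by (simp add: o_def)
  then show ?thesis
    using assms by (intro smooth_polynomial real_polynomial_function.intros(4))
qed

lemma smooth_field_vector:
  assumes "smooth u1" "smooth u2" "smooth u3"
  shows "smooth_field (\<lambda>x. vector [u1 x, u2 x, u3 x])"
  unfolding smooth_field_def
proof
  fix i :: 3
  show "smooth (\<lambda>x. (vector [u1 x, u2 x, u3 x] :: real^3) $ i)"
    using assms exhaust_3[of i] by (auto simp: vector_3)
qed

lemma curl_vector:
  "curl (\<lambda>x. vector [u1 x, u2 x, u3 x]) x = vector [partial 2 u3 x - partial 3 u2 x,
     partial 3 u1 x - partial 1 u3 x, partial 1 u2 x - partial 2 u1 x]"
  by (simp add: curl_def vector_3)

text \<open>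
  The field is the gradient of \<open>f (y\<^sub>1) g (y\<^sub>2) h (y\<^sub>3)\<close>. As a test field it turns the weak identity
  \<open>w = curl A\<close> into the statement that \<open>w\<close> is divergence free. For a product the mixed second
  derivatives can be read off, so their symmetry is evident.
\<close>

lemma component_product_gradient_curl_free:
  assumes poly: "real_polynomial_function f" "real_polynomial_function g" "real_polynomial_function h"
    and deriv: "\<And>t. (f has_real_derivative f' t) (at t)" "\<And>t. (g has_real_derivative g' t) (at t)"
      "\<And>t. (h has_real_derivative h' t) (at t)"
  defines "\<Psi> \<equiv> \<lambda>y::real^3. vector [f' (y $ 1) * g (y $ 2) * h (y $ 3), f (y $ 1) * g' (y $ 2) * h (y $ 3),
      f (y $ 1) * g (y $ 2) * h' (y $ 3)] :: real^3"
  shows "smooth_field \<Psi>" "curl \<Psi> x = 0"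
proof -
  have ex: "real_polynomial_function F' \<and> (\<exists>F''. \<forall>t. (F' has_real_derivative F'' t) (at t))"
    if F: "real_polynomial_function F" and D: "\<And>t. (F has_real_derivative F' t) (at t)" for F F'
  proof -
    obtain p where p: "real_polynomial_function p" "\<And>t. (F has_real_derivative p t) (at t)"
      using has_real_derivative_polynomial_function[OF F] by blast
    then have "p = F'" using D DERIV_unique by blast
    with p has_real_derivative_polynomial_function[of F'] show ?thesis by blast
  qed
  obtain f'' g'' h'' where d2: "\<And>t. (f' has_real_derivative f'' t) (at t)"
      "\<And>t. (g' has_real_derivative g'' t) (at t)" "\<And>t. (h' has_real_derivative h'' t) (at t)"
    using ex[OF poly(1) deriv(1)] ex[OF poly(2) deriv(2)] ex[OF poly(3) deriv(3)] by metis
  have poly': "real_polynomial_function f'" "real_polynomial_function g'" "real_polynomial_function h'"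
    using ex[OF poly(1) deriv(1)] ex[OF poly(2) deriv(2)] ex[OF poly(3) deriv(3)] by auto
  show "smooth_field \<Psi>"
    unfolding \<Psi>_def using poly poly' by (intro smooth_field_vector smooth_component_product)
  show "curl \<Psi> x = 0"
    unfolding \<Psi>_def curl_vector
    by (simp add: partial_component_product[OF d2(1) deriv(2,3)]
        partial_component_product[OF deriv(1) d2(2) deriv(3)]
        partial_component_product[OF deriv(1,2) d2(3)] vec_eq_iff forall_3 vector_3)
qed

text \<open>
  With an antiderivative \<open>P\<close> of the mollifier \<open>\<kappa>\<close>, this is the integral over \<open>t\<close> from \<open>a\<close> to \<open>x\<^sub>3\<close> of
  the three-dimensional mollifier \<open>\<kappa> (x\<^sub>1 - y\<^sub>1) \<kappa> (x\<^sub>2 - y\<^sub>2) \<kappa> (t - y\<^sub>3)\<close>.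
\<close>

definition potential_kernel :: "(real \<Rightarrow> real) \<Rightarrow> (real \<Rightarrow> real) \<Rightarrow> real \<Rightarrow> real^3 \<Rightarrow> real^3 \<Rightarrow> real" where
  "potential_kernel \<kappa> P a x y = \<kappa> (x $ 1 - y $ 1) * \<kappa> (x $ 2 - y $ 2) * (P (x $ 3 - y $ 3) - P (a - y $ 3))"

text \<open>
  A divergence free field \<open>w\<close> that vanishes on the plane \<open>x\<^sub>3 = a\<close> has the explicit vector potential
  whose first two components are the integrals of \<open>w\<^sub>2\<close> and \<open>- w\<^sub>1\<close> over the third variable, starting
  from that plane, and whose third component is zero. Here this recipe is applied to the mollification
  of \<open>w\<close>.
\<close>

definition potential ::
  "(real^3) set \<Rightarrow> (real \<Rightarrow> real) \<Rightarrow> (real \<Rightarrow> real) \<Rightarrow> real \<Rightarrow> (real^3 \<Rightarrow> real^3) \<Rightarrow> real^3 \<Rightarrow> real^3" where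
  "potential \<Omega> \<kappa> P a w x = vector
     [LINT y|lebesgue_on \<Omega>. potential_kernel \<kappa> P a x y * w y $ 2,
      LINT y|lebesgue_on \<Omega>. potential_kernel \<kappa> P a x y * - w y $ 1, 0]"

lemma continuous_polynomial: "real_polynomial_function f \<Longrightarrow> continuous_on S f"
  using continuous_on_polymonial_function real_polynomial_function_eq by blast

lemma separable_potential_kernel:
  assumes "real_polynomial_function \<kappa>" "real_polynomial_function P"
  shows "separable (potential_kernel \<kappa> P a)"
proof -
  have "continuous_on UNIV (\<lambda>y::real^3. - P (a - y $ 3))"
    using continuous_polynomial[OF assms(2), of UNIV]
    by (auto intro!: continuous_intros elim!: continuous_on_compose2)
  then have "separable (\<lambda>x y. \<kappa> (x $ 1 - y $ 1) * \<kappa> (x $ 2 - y $ 2) * (P (x $ 3 - y $ 3) + - P (a - y $ 3)))"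
    using assms
    by (intro separable_mult separable_add separable_polynomial_diff separable_snd)
  then show ?thesis by (simp add: potential_kernel_def[abs_def])
qed

lemma integrable_component: "integrable M w \<Longrightarrow> integrable M (\<lambda>y. (w y :: real^3) $ i)"
  using integrable_inner_left[of "axis i 1" M w] by (simp add: inner_axis)

lemma smooth_field_potential:
  assumes "real_polynomial_function \<kappa>" "real_polynomial_function P" "bounded \<Omega>"
    "integrable (lebesgue_on \<Omega>) w"
  shows "smooth_field (potential \<Omega> \<kappa> P a w)"
  unfolding potential_def[abs_def] using assms
  by (intro smooth_field_vector separable_integral_smooth separable_potential_kernel smooth_const
      Bochner_Integration.integrable_minus integrable_component)

text \<open>
  The first two components of the curl undo the integration in the third variable. In the third
  component, \<open>\<partial>\<^sub>1 w\<^sub>1 + \<partial>\<^sub>2 w\<^sub>2\<close> is replaced by \<open>- \<partial>\<^sub>3 w\<^sub>3\<close>; integrating the latter from \<open>a\<close> leaves the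
  mollification of \<open>w\<^sub>3\<close> minus its value on the plane \<open>x\<^sub>3 = a\<close>. Since \<open>w\<close> is divergence free only
  weakly, the replacement is made by moving the derivatives to the kernel: for fixed \<open>x\<close>, the gradient
  of the kernel with respect to \<open>y\<close> is a curl free test field.
\<close>

lemma curl_potential:
  assumes poly: "real_polynomial_function \<kappa>" "real_polynomial_function P"
    and P: "\<And>t. (P has_real_derivative \<kappa> t) (at t)"
    and Om: "bounded \<Omega>" "integrable (lebesgue_on \<Omega>) w"
    and weak: "\<And>\<Phi>. smooth_field \<Phi> \<Longrightarrow>
      (LINT x|lebesgue_on \<Omega>. A x \<bullet> curl \<Phi> x) = (LINT x|lebesgue_on \<Omega>. w x \<bullet> \<Phi> x)"
  shows "curl (potential \<Omega> \<kappa> P a w) x =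
    (\<chi> i. LINT y|lebesgue_on \<Omega>. (\<Prod>j\<in>UNIV. \<kappa> (x $ j - y $ j)) * w y $ i)
    - axis 3 (LINT y|lebesgue_on \<Omega>. \<kappa> (x $ 1 - y $ 1) * \<kappa> (x $ 2 - y $ 2) * \<kappa> (a - y $ 3) * w y $ 3)"
proof -
  let ?M = "lebesgue_on \<Omega>"
  let ?k = "potential_kernel \<kappa> P a"
  obtain \<kappa>' where k': "\<And>t. (\<kappa> has_real_derivative \<kappa>' t) (at t)"
    using has_real_derivative_polynomial_function[OF poly(1)] by blast
  note sep = separable_potential_kernel[OF poly, of a]
  have wi: "integrable ?M (\<lambda>y. w y $ i)" "integrable ?M (\<lambda>y. - w y $ i)" for i
    using integrable_component[OF Om(2)] by auto
  define E where "E y = P (x $ 3 - y $ 3) - P (a - y $ 3)" for y :: "real^3"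
  have shift: "((\<lambda>s. F (s - c)) has_real_derivative F' (t - c)) (at t)"
    if "\<And>t. (F has_real_derivative F' t) (at t)" for F F' c t
    using DERIV_chain2[OF that[of "t - c"] DERIV_diff[OF DERIV_ident DERIV_const]] by simp
  have pk: "partial 1 (\<lambda>x. ?k x y) x = \<kappa>' (x $ 1 - y $ 1) * \<kappa> (x $ 2 - y $ 2) * E y"
    "partial 2 (\<lambda>x. ?k x y) x = \<kappa> (x $ 1 - y $ 1) * \<kappa>' (x $ 2 - y $ 2) * E y"
    "partial 3 (\<lambda>x. ?k x y) x = \<kappa> (x $ 1 - y $ 1) * \<kappa> (x $ 2 - y $ 2) * \<kappa> (x $ 3 - y $ 3)" for y
  proof -
    have "((\<lambda>s. P (s - y $ 3) - P (a - y $ 3)) has_real_derivative \<kappa> (x $ 3 - y $ 3) - 0) (at (x $ 3))"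
      by (rule DERIV_diff[OF shift[OF P] DERIV_const])
    then have "((\<lambda>s. P (s - y $ 3) - P (a - y $ 3)) has_real_derivative \<kappa> (x $ 3 - y $ 3)) (at (x $ 3))"
      by simp
    note partial_component_product[OF shift[OF k'] shift[OF k'] this]
    then show "partial 1 (\<lambda>x. ?k x y) x = \<kappa>' (x $ 1 - y $ 1) * \<kappa> (x $ 2 - y $ 2) * E y"
      "partial 2 (\<lambda>x. ?k x y) x = \<kappa> (x $ 1 - y $ 1) * \<kappa>' (x $ 2 - y $ 2) * E y"
      "partial 3 (\<lambda>x. ?k x y) x = \<kappa> (x $ 1 - y $ 1) * \<kappa> (x $ 2 - y $ 2) * \<kappa> (x $ 3 - y $ 3)"
      by (simp_all add: potential_kernel_def E_def)
  qed
  define K where "K y = \<kappa> (x $ 1 - y $ 1) * \<kappa> (x $ 2 - y $ 2) * \<kappa> (x $ 3 - y $ 3)" for y :: "real^3"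
  define K0 where "K0 y = \<kappa> (x $ 1 - y $ 1) * \<kappa> (x $ 2 - y $ 2) * \<kappa> (a - y $ 3)" for y :: "real^3"
  \<comment> \<open>\<open>\<Psi>\<close> is the gradient of the potential kernel with respect to its second argument.\<close>
  define \<Psi> where "\<Psi> y = (vector [- \<kappa>' (x $ 1 - y $ 1) * \<kappa> (x $ 2 - y $ 2) * E y,
      \<kappa> (x $ 1 - y $ 1) * - \<kappa>' (x $ 2 - y $ 2) * E y,
      \<kappa> (x $ 1 - y $ 1) * \<kappa> (x $ 2 - y $ 2) * (- \<kappa> (x $ 3 - y $ 3) + \<kappa> (a - y $ 3))] :: real^3)" for y
  have pc: "real_polynomial_function (\<lambda>t. F (c - t))" if "real_polynomial_function F" for F :: "real \<Rightarrow> real" and c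
  proof -
    have "polynomial_function (\<lambda>t. c - t)"
      by (rule polynomial_function_diff[OF polynomial_function_const polynomial_function_id])
    from real_polynomial_function_compose[OF this that] show ?thesis by (simp add: o_def)
  qed
  have flip: "((\<lambda>s. F (c - s)) has_real_derivative - F' (c - t)) (at t)"
    if "\<And>t. (F has_real_derivative F' t) (at t)" for F F' c t
    using DERIV_chain2[OF that[of "c - t"] DERIV_diff[OF DERIV_const DERIV_ident]] by simp
  have flipE: "((\<lambda>s. P (x $ 3 - s) - P (a - s)) has_real_derivative - \<kappa> (x $ 3 - t) + \<kappa> (a - t)) (at t)" for t
    using DERIV_diff[OF flip[OF P] flip[OF P], of "x $ 3" a t] by simp
  have \<Psi>: "smooth_field \<Psi>" "curl \<Psi> z = 0" for z
    unfolding \<Psi>_def[abs_def] E_def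
    by (rule component_product_gradient_curl_free[where f = "\<lambda>s. \<kappa> (x $ 1 - s)"
          and g = "\<lambda>s. \<kappa> (x $ 2 - s)" and h = "\<lambda>s. P (x $ 3 - s) - P (a - s)"];
        intro pc poly flip k' flipE real_polynomial_function_diff)+
  have "(LINT y|?M. w y \<bullet> \<Psi> y) = 0" using weak[OF \<Psi>(1)] by (simp add: \<Psi>(2))
  have i: "integrable ?M (\<lambda>y. partial j (\<lambda>x. ?k x y) x * w y $ l)" for j l
    by (rule separable_integral_partial(1)[OF sep Om(1) wi(1)])
  have iK: "integrable ?M (\<lambda>y. K y * w y $ l)" for l
    using i[of 3 l] by (simp add: pk K_def)
  have iK0: "integrable ?M (\<lambda>y. K0 y * w y $ 3)"
  proof -
    have "continuous_on UNIV (\<lambda>y. \<kappa> (a - y $ 3))"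
      using continuous_polynomial[OF poly(1), of UNIV] 
      by (auto intro!: continuous_intros elim!: continuous_on_compose2)
    then have "separable (\<lambda>x y. \<kappa> (x $ 1 - y $ 1) * \<kappa> (x $ 2 - y $ 2) * \<kappa> (a - y $ 3))"
      using poly by (intro separable_mult separable_polynomial_diff separable_snd)
    from separable_integrable[OF this Om(1) wi(1)] show ?thesis unfolding K0_def .
  qed
  have "w y \<bullet> \<Psi> y = - (partial 1 (\<lambda>x. ?k x y) x * w y $ 1) - partial 2 (\<lambda>x. ?k x y) x * w y $ 2
     - K y * w y $ 3 + K0 y * w y $ 3" for y
    by (simp add: \<Psi>_def inner_vec_def sum_3 vector_3 pk K_def K0_def algebra_simps)
  with \<open>(LINT y|?M. w y \<bullet> \<Psi> y) = 0\<close> have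
    div0: "- (LINT y|?M. partial 1 (\<lambda>x. ?k x y) x * w y $ 1) - (LINT y|?M. partial 2 (\<lambda>x. ?k x y) x * w y $ 2)
      - (LINT y|?M. K y * w y $ 3) + (LINT y|?M. K0 y * w y $ 3) = 0"
    using i iK iK0 by simp
  note sp = separable_integral_partial(2)[OF sep Om(1)]
  have "curl (potential \<Omega> \<kappa> P a w) x = vector [LINT y|?M. K y * w y $ 1, LINT y|?M. K y * w y $ 2,
      - (LINT y|?M. partial 1 (\<lambda>x. ?k x y) x * w y $ 1) - (LINT y|?M. partial 2 (\<lambda>x. ?k x y) x * w y $ 2)]"
    unfolding potential_def[abs_def] curl_vector sp[OF wi(1)] sp[OF wi(2)]
    by (simp add: partial_const pk(3) K_def)
  also have "\<dots> = (\<chi> i. LINT y|?M. K y * w y $ i) - axis 3 (LINT y|?M. K0 y * w y $ 3)"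
    using div0 by (simp add: vec_eq_iff forall_3 vector_3 axis_def)
  finally show ?thesis by (simp add: K_def K0_def UNIV_3_prod)
qed

section \<open>Mass and concentration of the mollifier\<close>

lemma continuous_component:
  fixes f :: "real \<Rightarrow> real"
  shows "continuous_on UNIV f \<Longrightarrow> continuous_on UNIV (\<lambda>x::real^'n. f (x $ i))"
  by (rule continuous_on_compose2[of UNIV f UNIV "\<lambda>x. x $ i"]) (auto intro: continuous_intros)

lemma continuous_reflect:
  fixes f :: "real \<Rightarrow> real"
  shows "continuous_on UNIV f \<Longrightarrow> continuous_on UNIV (\<lambda>t. f (p - t))"
  by (rule continuous_on_compose2[of UNIV f UNIV "\<lambda>t. p - t"]) (auto intro!: continuous_intros)

lemma integral_component_product_le:
  fixes f :: "3 \<Rightarrow> real \<Rightarrow> real" and l u :: "real^3"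
  assumes Om: "\<Omega> \<in> sets lebesgue" "\<Omega> \<subseteq> cbox l u"
    and c: "\<And>i. continuous_on UNIV (f i)" and nn: "\<And>i t. l $ i \<le> t \<Longrightarrow> t \<le> u $ i \<Longrightarrow> 0 \<le> f i t"
  shows "(LINT y|lebesgue_on \<Omega>. (\<Prod>i\<in>UNIV. f i (y $ i))) \<le> (\<Prod>i\<in>UNIV. integral {l$i..u$i} (f i))"
proof -
  let ?g = "\<lambda>y::real^3. \<Prod>i\<in>UNIV. f i (y $ i)"
  have "continuous_on UNIV ?g"
    using c by (intro continuous_on_prod continuous_component)
  then have int: "integrable (lebesgue_on S) ?g" if "bounded S" "S \<in> sets lebesgue" for S
    using that by (intro integrable_continuous_bounded)
  have bo: "bounded \<Omega>" using Om bounded_subset bounded_cbox by blast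
  have "(LINT y|lebesgue_on \<Omega>. ?g y) = (LINT y|lebesgue. indicator \<Omega> y *\<^sub>R ?g y)"
    using Om by (subst integral_restrict_space) auto
  also have "\<dots> \<le> (LINT y|lebesgue. indicator (cbox l u) y *\<^sub>R ?g y)"
  proof (rule integral_mono)
    show "integrable lebesgue (\<lambda>y. indicator \<Omega> y *\<^sub>R ?g y)"
      using int[OF bo Om(1)] Om by (subst (asm) integrable_restrict_space) auto
    show "integrable lebesgue (\<lambda>y. indicator (cbox l u) y *\<^sub>R ?g y)"
      using int[of "cbox l u"] integrable_restrict_space[of "cbox l u" lebesgue ?g] by simp
    have "0 \<le> ?g y" if "y \<in> cbox l u" for y
      using that nn by (intro prod_nonneg) (auto simp: mem_box_cart)
    then show "indicator \<Omega> y *\<^sub>R ?g y \<le> indicator (cbox l u) y *\<^sub>R ?g y" for y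
      using Om(2) by (auto simp: indicator_def)
  qed
  also have "\<dots> = (LINT y|lebesgue_on (cbox l u). ?g y)"
    by (subst integral_restrict_space) auto
  also have "\<dots> = (\<Prod>i\<in>UNIV. integral {l$i..u$i} (f i))"
    using c nn by (rule integral_cbox_prod)
  finally show ?thesis .
qed

lemma integral_component_product_cube_le:
  fixes f g h :: "real \<Rightarrow> real"
  assumes Om: "\<Omega> \<in> sets lebesgue" "\<And>x i. x \<in> \<Omega> \<Longrightarrow> \<bar>x $ i\<bar> \<le> m"
    and c: "continuous_on UNIV f" "continuous_on UNIV g" "continuous_on UNIV h"
    and nn: "\<And>t. \<bar>t\<bar> \<le> m \<Longrightarrow> 0 \<le> f t" "\<And>t. \<bar>t\<bar> \<le> m \<Longrightarrow> 0 \<le> g t" "\<And>t. \<bar>t\<bar> \<le> m \<Longrightarrow> 0 \<le> h t"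
    and le: "integral {-m..m} f \<le> c1" "integral {-m..m} g \<le> c2" "integral {-m..m} h \<le> c3"
  shows "(LINT y|lebesgue_on \<Omega>. f (y $ 1) * g (y $ 2) * h ((y::real^3) $ 3)) \<le> c1 * c2 * c3"
proof -
  define F :: "3 \<Rightarrow> real \<Rightarrow> real" where "F i = (if i = 1 then f else if i = 2 then g else h)" for i
  have F: "F 1 = f" "F 2 = g" "F 3 = h" by (auto simp: F_def)
  have "(LINT y|lebesgue_on \<Omega>. (\<Prod>i\<in>UNIV. F i (y $ i)))
      \<le> (\<Prod>i\<in>UNIV. integral {(\<chi> i. - m)$i..(\<chi> i. m)$i} (F i))"
  proof (rule integral_component_product_le[OF Om(1)])
    show "\<Omega> \<subseteq> cbox (\<chi> i. - m) (\<chi> i. m)"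
      using Om(2) by (auto simp: mem_box_cart abs_le_iff minus_le_iff)
    show "continuous_on UNIV (F i)" for i using c by (simp add: F_def)
    show "0 \<le> F i t" if "(\<chi> i. - m) $ i \<le> t" "t \<le> (\<chi> i. m) $ i" for i t
      using that nn[of t] by (auto simp: F_def abs_le_iff)
  qed
  then have "(LINT y|lebesgue_on \<Omega>. f (y $ 1) * g (y $ 2) * h (y $ 3))
      \<le> integral {-m..m} f * integral {-m..m} g * integral {-m..m} h"
    by (simp add: UNIV_3_prod F)
  also have "\<dots> \<le> c1 * c2 * c3"
  proof -
    have p: "0 \<le> integral {-m..m} F" if "continuous_on UNIV F" "\<And>t. \<bar>t\<bar> \<le> m \<Longrightarrow> 0 \<le> F t" for F :: "real \<Rightarrow> real"
      using that by (intro integral_nonneg integrable_continuous_real) (auto intro: continuous_on_subset)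
    have "0 \<le> integral {-m..m} f" "0 \<le> integral {-m..m} g" "0 \<le> integral {-m..m} h"
      using p c nn by auto
    then show ?thesis using le by (intro mult_mono) (auto intro: mult_nonneg_nonneg order_trans)
  qed
  finally show ?thesis .
qed

lemma integral_landau_shift:
  "integral {p - d..p + d} (\<lambda>t. landau R n (p - t)) = integral {-d..d} (landau R n)"
proof -
  have "integral {p - d..p + d} (landau R n \<circ> (\<lambda>x. x + - p)) = integral {p - d + - p..p + d + - p} (landau R n)"
    by (rule integral_shift) (rule continuous_landau)
  moreover have "landau R n (x + - p) = landau R n (p - x)" for x
    using landau_even[of R n "p - x"] by simp
  ultimately show ?thesis by (simp add: o_def)
qed

text \<open>
  The mass of the kernel splits into the part on a small cube \<open>Q\<close> around \<open>x\<close>, where \<open>g\<close> is within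
  \<open>e / 2\<close> of \<open>c\<close>, and the rest. The mass on \<open>Q\<close> is the cube \<open>\<theta> n\<close> of the one-dimensional mass, which
  tends to one, and the total mass over \<open>\<Omega>\<close> is at most one; hence the rest is at most \<open>1 - \<theta> n\<close> and
  contributes little for bounded \<open>g\<close>.
\<close>

lemma approximate_identity:
  fixes g :: "real^3 \<Rightarrow> real"
  assumes Om: "bounded \<Omega>" "open \<Omega>" and R: "R > 0" and x: "x \<in> \<Omega>"
    and near: "\<And>y i. y \<in> \<Omega> \<Longrightarrow> \<bar>x $ i - y $ i\<bar> \<le> R"
    and g: "integrable (lebesgue_on \<Omega>) g" "AE y in lebesgue_on \<Omega>. \<bar>g y\<bar> \<le> N"
    and cont: "\<And>\<epsilon>. \<epsilon> > 0 \<Longrightarrow> \<exists>\<delta>>0. AE y in lebesgue_on \<Omega>. dist y x < \<delta> \<longrightarrow> \<bar>g y - c\<bar> \<le> \<epsilon>"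
  shows "(\<lambda>n. LINT y|lebesgue_on \<Omega>. (\<Prod>i\<in>UNIV. landau R n (x $ i - y $ i)) * g y) \<longlonglongrightarrow> c"
proof (rule LIMSEQ_I)
  fix e :: real assume e: "e > 0"
  let ?M = "lebesgue_on \<Omega>"
  define K where "K n y = (\<Prod>i\<in>UNIV. landau R n (x $ i - y $ i))" for n and y :: "real^3"
  have ms: "\<Omega> \<in> sets lebesgue" using Om by (simp add: borel_open sets_completionI_sets)
  obtain \<delta> where \<delta>: "\<delta> > 0" "AE y in ?M. dist y x < \<delta> \<longrightarrow> \<bar>g y - c\<bar> \<le> e / 2"
    using cont[of "e / 2"] e by auto
  obtain r where r: "r > 0" "ball x r \<subseteq> \<Omega>" using Om(2) x open_contains_ball by blast
  \<comment> \<open>A cube of half-width \<open>\<eta>\<close> lies in the ball of radius \<open>3 \<eta>\<close>, because the Euclidean norm is at most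
  the sum of the moduli of the three coordinates.\<close>
  define \<eta> where "\<eta> = min R (min \<delta> r / 4)"
  have \<eta>: "0 < \<eta>" "\<eta> \<le> R" "3 * \<eta> < \<delta>" "3 * \<eta> < r" using \<delta> r R by (auto simp: \<eta>_def)
  define Q where "Q = cbox (\<chi> i. x $ i - \<eta>) (\<chi> i. x $ i + \<eta>)"
  have Q: "dist y x \<le> 3 * \<eta>" if "y \<in> Q" for y
  proof -
    have "dist y x \<le> (\<Sum>i\<in>UNIV. \<bar>(y - x) $ i\<bar>)" unfolding dist_norm by (rule norm_le_l1_cart)
    also have "\<dots> \<le> (\<Sum>i\<in>(UNIV::3 set). \<eta>)"
      using that by (intro sum_mono) (auto simp: Q_def mem_box_cart abs_le_iff algebra_simps)
    finally show ?thesis by simp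
  qed
  have QO: "Q \<subseteq> \<Omega>"
  proof
    fix y assume "y \<in> Q"
    with Q[of y] \<eta> have "y \<in> ball x r" by (auto simp: dist_commute)
    with r show "y \<in> \<Omega>" by blast
  qed
  have Kc: "continuous_on UNIV (K n)" for n unfolding K_def
    by (intro continuous_on_prod continuous_component continuous_reflect continuous_landau)
  have Ki: "integrable ?M (K n)" for n
    using Om(1) ms Kc by (rule integrable_continuous_bounded)
  have Kn: "0 \<le> K n y" if "y \<in> \<Omega>" for n y
    unfolding K_def using near[OF that] R by (intro prod_nonneg landau_nonneg) auto
  have lc: "continuous_on UNIV (\<lambda>t. landau R n (p - t))" for n p
    by (intro continuous_reflect continuous_landau)
  have mass: "(LINT y|?M. K n y) \<le> 1" for n
  proof -
    have "(LINT y|?M. K n y) \<le> (\<Prod>i\<in>UNIV. integral {(\<chi> i. x $ i - R)$i..(\<chi> i. x $ i + R)$i} (\<lambda>t. landau R n (x $ i - t)))"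
      unfolding K_def
    proof (rule integral_component_product_le[OF ms])
      show "\<Omega> \<subseteq> cbox (\<chi> i. x $ i - R) (\<chi> i. x $ i + R)"
      proof
        fix y assume "y \<in> \<Omega>"
        from near[OF this] show "y \<in> cbox (\<chi> i. x $ i - R) (\<chi> i. x $ i + R)"
          by (simp add: mem_box_cart abs_le_iff diff_le_eq le_diff_eq add.commute)
      qed
    qed (use lc R in \<open>auto intro!: landau_nonneg\<close>)
    also have "\<dots> = 1" using R by (simp add: integral_landau_shift integral_landau)
    finally show ?thesis .
  qed
  define \<theta> where "\<theta> n = integral {-\<eta>..\<eta>} (landau R n) ^ 3" for n
  have qi: "integrable ?M (\<lambda>y. indicator Q y * K n y)" for n
  proof -
    have "Q \<in> sets ?M" using QO ms by (subst sets_restrict_space_iff) (auto simp: Q_def)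
    from integrable_mult_indicator[OF this Ki[of n]] show ?thesis by simp
  qed
  have core: "(LINT y|?M. indicator Q y * K n y) = \<theta> n" for n
  proof -
    have "(LINT y|?M. indicator Q y * K n y) = (LINT y|lebesgue. indicator \<Omega> y *\<^sub>R (indicator Q y * K n y))"
      using ms by (subst integral_restrict_space) auto
    also have "\<dots> = (LINT y|lebesgue. indicator Q y *\<^sub>R K n y)"
      using QO by (intro Bochner_Integration.integral_cong) (auto simp: indicator_def)
    also have "\<dots> = (LINT y|lebesgue_on Q. K n y)"
      by (subst integral_restrict_space) (auto simp: Q_def)
    also have "\<dots> = (\<Prod>i\<in>(UNIV::3 set). integral {(\<chi> i. x $ i - \<eta>)$i..(\<chi> i. x $ i + \<eta>)$i} (\<lambda>t. landau R n (x $ i - t)))"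
      unfolding K_def Q_def
      by (rule integral_cbox_prod) (use lc R \<eta> in \<open>auto intro!: landau_nonneg\<close>)
    also have "\<dots> = \<theta> n" by (simp add: integral_landau_shift \<theta>_def)
    finally show ?thesis .
  qed
  have "(\<lambda>n. (\<bar>N\<bar> + 2 * \<bar>c\<bar>) * (1 - \<theta> n)) \<longlonglongrightarrow> (\<bar>N\<bar> + 2 * \<bar>c\<bar>) * (1 - 1 ^ 3)"
    unfolding \<theta>_def using landau_concentrates[OF R \<eta>(1,2)] by (intro tendsto_intros)
  then have tail: "eventually (\<lambda>n. (\<bar>N\<bar> + 2 * \<bar>c\<bar>) * (1 - \<theta> n) < e / 2) sequentially"
    using e by (intro order_tendstoD) auto
  have error: "\<bar>(LINT y|?M. K n y * g y) - c\<bar> \<le> e / 2 + (\<bar>N\<bar> + 2 * \<bar>c\<bar>) * (1 - \<theta> n)" for n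
  proof -
    have Kgi: "integrable ?M (\<lambda>y. K n y * g y)"
      using Om(1) Kc g(1) by (rule integrable_mult_continuous)
    have t1: "\<theta> n \<le> (LINT y|?M. K n y)"
      unfolding core[symmetric] using qi Ki Kn
      by (intro integral_mono) (auto simp: indicator_def space_restrict_space)
    have "\<bar>LINT y|?M. K n y * g y - c * K n y\<bar> \<le> (LINT y|?M. \<bar>K n y * g y - c * K n y\<bar>)"
      using integral_norm_bound[of ?M "\<lambda>y. K n y * g y - c * K n y"] by simp
    also have "\<dots> \<le> (LINT y|?M. K n y * (e / 2) + (\<bar>N\<bar> + \<bar>c\<bar>) * (K n y - indicator Q y * K n y))"
    proof (rule integral_mono_AE)
      have "AE y in ?M. y \<in> \<Omega>" by (auto simp: space_restrict_space intro!: AE_I2)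
      with \<delta>(2) g(2) show "AE y in ?M. \<bar>K n y * g y - c * K n y\<bar>
          \<le> K n y * (e / 2) + (\<bar>N\<bar> + \<bar>c\<bar>) * (K n y - indicator Q y * K n y)"
      proof eventually_elim
        case (elim y)
        have k: "0 \<le> K n y" using Kn elim by blast
        have "K n y * g y - c * K n y = K n y * (g y - c)" by (simp add: algebra_simps)
        then have "\<bar>K n y * g y - c * K n y\<bar> = K n y * \<bar>g y - c\<bar>"
          using k by (simp only: abs_mult abs_of_nonneg)
        moreover have "K n y * \<bar>g y - c\<bar> \<le> K n y * (e / 2)" if "y \<in> Q"
          using Q[OF that] \<eta> elim k by (intro mult_left_mono) auto
        moreover have "K n y * \<bar>g y - c\<bar> \<le> K n y * (\<bar>N\<bar> + \<bar>c\<bar>)"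
          using elim k by (intro mult_left_mono) auto
        moreover have "0 \<le> K n y * (e / 2)" using k e by simp
        ultimately show ?case by (cases "y \<in> Q") (auto simp: mult.commute)
      qed
    qed (use Kgi Ki qi in auto)
    also have "\<dots> = (LINT y|?M. K n y) * (e / 2) + (\<bar>N\<bar> + \<bar>c\<bar>) * ((LINT y|?M. K n y) - \<theta> n)"
      using Ki qi by (simp add: core)
    also have "\<dots> \<le> 1 * (e / 2) + (\<bar>N\<bar> + \<bar>c\<bar>) * (1 - \<theta> n)"
      using mult_right_mono[OF mass[of n], of "e / 2"] e
        mult_left_mono[of "(LINT y|?M. K n y) - \<theta> n" "1 - \<theta> n" "\<bar>N\<bar> + \<bar>c\<bar>"] mass[of n]
      by (intro add_mono) auto
    finally have 1: "\<bar>LINT y|?M. K n y * g y - c * K n y\<bar> \<le> e / 2 + (\<bar>N\<bar> + \<bar>c\<bar>) * (1 - \<theta> n)" by simp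
    have 2: "(LINT y|?M. K n y * g y - c * K n y) = (LINT y|?M. K n y * g y) - c * (LINT y|?M. K n y)"
      using Kgi Ki by simp
    have 3: "\<bar>c * (1 - (LINT y|?M. K n y))\<bar> \<le> \<bar>c\<bar> * (1 - \<theta> n)"
      unfolding abs_mult using mass[of n] t1 by (intro mult_left_mono) auto
    have "(LINT y|?M. K n y * g y) - c
        = (LINT y|?M. K n y * g y - c * K n y) - c * (1 - (LINT y|?M. K n y))"
      unfolding 2 by (simp add: algebra_simps)
    then have "\<bar>(LINT y|?M. K n y * g y) - c\<bar>
        \<le> e / 2 + (\<bar>N\<bar> + \<bar>c\<bar>) * (1 - \<theta> n) + \<bar>c\<bar> * (1 - \<theta> n)"
      using 1 3 by linarith
    then show ?thesis by (simp add: algebra_simps)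
  qed
  from tail have "eventually (\<lambda>n. norm ((LINT y|?M. K n y * g y) - c) < e) sequentially"
  proof eventually_elim
    case (elim n)
    with error[of n] show ?case by simp
  qed
  then show "\<exists>no. \<forall>n\<ge>no. norm ((LINT y|lebesgue_on \<Omega>. (\<Prod>i\<in>UNIV. landau R n (x $ i - y $ i)) * g y) - c) < e"
    by (simp add: eventually_sequentially K_def)
qed

section \<open>Bounds for the potential kernel\<close>

lemma integral_weighted_bound:
  fixes k g :: "real^3 \<Rightarrow> real"
  assumes Om: "bounded \<Omega>" "\<Omega> \<in> sets lebesgue" and k: "continuous_on UNIV k" "\<And>y. y \<in> \<Omega> \<Longrightarrow> 0 \<le> k y"
    and c: "(LINT y|lebesgue_on \<Omega>. k y) \<le> c" and N: "0 \<le> N"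
    and g: "integrable (lebesgue_on \<Omega>) g" "AE y in lebesgue_on \<Omega>. \<bar>g y\<bar> \<le> N"
  shows "\<bar>LINT y|lebesgue_on \<Omega>. k y * g y\<bar> \<le> c * N"
proof -
  let ?M = "lebesgue_on \<Omega>"
  have ki: "integrable ?M k" using Om k by (intro integrable_continuous_bounded)
  have kg: "integrable ?M (\<lambda>y. k y * g y)" using Om k g by (intro integrable_mult_continuous)
  have "\<bar>LINT y|?M. k y * g y\<bar> \<le> (LINT y|?M. \<bar>k y * g y\<bar>)"
    using integral_norm_bound[of ?M "\<lambda>y. k y * g y"] by simp
  also have "\<dots> \<le> (LINT y|?M. k y * N)"
  proof (rule integral_mono_AE)
    have "AE y in ?M. y \<in> \<Omega>" by (auto simp: space_restrict_space intro!: AE_I2)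
    with g(2) show "AE y in ?M. \<bar>k y * g y\<bar> \<le> k y * N"
      by eventually_elim (auto simp: abs_mult k intro!: mult_left_mono)
  qed (use ki kg in auto)
  also have "\<dots> \<le> c * N" using c N by (simp add: mult_right_mono)
  finally show ?thesis .
qed

text \<open>
  The domain lies in the cube \<open>[- m, m]\<^sup>3\<close>. Integration in the third variable starts at the plane
  \<open>a = - 2 m\<close>, which has distance at least \<open>m\<close> from the domain, so that the mollified field is
  uniformly small there. For the arguments \<open>t - y\<^sub>3\<close> with \<open>- 2 m \<le> t \<le> m\<close> to lie in the interval
  \<open>[- R, R]\<close> on which the Landau kernel is controlled, \<open>R = 3 m\<close> is required.
\<close>

context
  fixes m R a :: real and n :: nat and P :: "real \<Rightarrow> real"
  assumes m: "m > 0" and R: "R = 3 * m" and a: "a = - 2 * m"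
    and P: "\<And>t. (P has_real_derivative landau R n t) (at t)" "real_polynomial_function P"
begin

lemmas continuous_landau_reflect = continuous_reflect[OF continuous_landau[of UNIV]]

lemma antiderivative_increment:
  assumes "\<bar>p\<bar> \<le> m" "\<bar>q\<bar> \<le> m"
  shows "0 \<le> P (p - q) - P (a - q)" "P (p - q) - P (a - q) \<le> 1"
proof -
  have le: "a - q \<le> p - q" and sub: "{a - q..p - q} \<subseteq> {-R..R}"
    using assms m by (auto simp: a R abs_le_iff)
  have "(landau R n has_integral P (p - q) - P (a - q)) {a - q..p - q}"
    using le P(1) by (intro fundamental_theorem_of_calculus)
      (auto simp: has_real_derivative_iff_has_vector_derivative[symmetric] intro: has_field_derivative_at_within)
  then have eq: "integral {a - q..p - q} (landau R n) = P (p - q) - P (a - q)"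
    by (rule integral_unique)
  have i: "landau R n integrable_on {u..v}" for u v
    by (intro integrable_continuous_real continuous_landau)
  have nn: "0 \<le> landau R n s" if "s \<in> {-R..R}" for s
    using that m by (intro landau_nonneg) (auto simp: R abs_le_iff)
  show "0 \<le> P (p - q) - P (a - q)"
    unfolding eq[symmetric] using sub nn by (intro integral_nonneg i) auto
  have "integral {a - q..p - q} (landau R n) \<le> integral {-R..R} (landau R n)"
    using sub nn by (intro integral_subset_le i) auto
  then show "P (p - q) - P (a - q) \<le> 1"
    using eq integral_landau[of R n] m by (simp add: R)
qed

lemma landau_nonneg_near: "\<bar>p\<bar> \<le> 2 * m \<Longrightarrow> \<bar>t\<bar> \<le> m \<Longrightarrow> 0 \<le> landau R n (p - t)"
  using m by (intro landau_nonneg) (auto simp: R)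

lemma integral_landau_slice:
  assumes "\<bar>p\<bar> \<le> 2 * m"
  shows "integral {-m..m} (\<lambda>t. landau R n (p - t)) \<le> 1"
proof -
  have i: "(\<lambda>t. landau R n (p - t)) integrable_on {u..v}" for u v
    using continuous_reflect[OF continuous_landau]
    by (intro integrable_continuous_real) (auto intro: continuous_on_subset)
  have "integral {-m..m} (\<lambda>t. landau R n (p - t)) \<le> integral {p - R..p + R} (\<lambda>t. landau R n (p - t))"
    using assms m by (intro integral_subset_le i) (auto simp: R abs_le_iff intro!: landau_nonneg)
  also have "\<dots> = 1" using m by (simp add: integral_landau_shift integral_landau R)
  finally show ?thesis .
qed

lemma integral_mollifier_le:
  assumes Om: "\<Omega> \<in> sets lebesgue" "\<And>x i. x \<in> \<Omega> \<Longrightarrow> \<bar>x $ i\<bar> \<le> m"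
    and p: "\<bar>p\<bar> \<le> 2 * m" "\<bar>q\<bar> \<le> 2 * m" "\<bar>r\<bar> \<le> 2 * m" and c: "integral {-m..m} (\<lambda>t. landau R n (r - t)) \<le> c"
  shows "(LINT y|lebesgue_on \<Omega>. landau R n (p - y $ 1) * landau R n (q - y $ 2) * landau R n (r - (y::real^3) $ 3)) \<le> c"
proof -
  have "(LINT y::real^3|lebesgue_on \<Omega>. landau R n (p - y $ 1) * landau R n (q - y $ 2) * landau R n (r - y $ 3))
      \<le> 1 * 1 * c"
    by (rule integral_component_product_cube_le[OF Om continuous_landau_reflect continuous_landau_reflect continuous_landau_reflect];
        (assumption | intro landau_nonneg_near integral_landau_slice p c))
  then show ?thesis by simp
qed

lemma potential_kernel_nonneg:
  assumes "\<And>i. \<bar>x $ i\<bar> \<le> m" "\<And>i. \<bar>y $ i\<bar> \<le> m"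
  shows "0 \<le> potential_kernel (landau R n) P a x y"
proof -
  have "\<bar>x $ i\<bar> \<le> 2 * m" for i using assms(1)[of i] m by simp
  then show ?thesis unfolding potential_kernel_def
    by (intro mult_nonneg_nonneg landau_nonneg_near antiderivative_increment assms)
qed

text \<open>
  The first two factors integrate to at most one, and the third is at most one on an interval of length
  \<open>2 m\<close>. This length is the constant in the final estimate.
\<close>

lemma potential_kernel_row:
  assumes Om: "\<Omega> \<in> sets lebesgue" "\<And>x i. x \<in> \<Omega> \<Longrightarrow> \<bar>x $ i\<bar> \<le> m" and x: "\<And>i. \<bar>x $ i\<bar> \<le> m"
  shows "(LINT y|lebesgue_on \<Omega>. potential_kernel (landau R n) P a x y) \<le> 2 * m"
proof -
  have x2: "\<bar>x $ i\<bar> \<le> 2 * m" for i using x[of i] m by simp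
  have Pc: "continuous_on UNIV P" using P(2) by (rule continuous_polynomial)
  have c: "continuous_on UNIV (\<lambda>t. P (x $ 3 - t) - P (a - t))"
    by (intro continuous_on_diff continuous_reflect Pc)
  have "integral {-m..m} (\<lambda>t. P (x $ 3 - t) - P (a - t)) \<le> integral {-m..m} (\<lambda>t. 1)"
    using x antiderivative_increment(2) c
    by (intro integral_le integrable_continuous_real) (auto intro: continuous_on_subset simp: abs_le_iff)
  then have i3: "integral {-m..m} (\<lambda>t. P (x $ 3 - t) - P (a - t)) \<le> 2 * m" using m by simp
  have "(LINT y|lebesgue_on \<Omega>. potential_kernel (landau R n) P a x y) \<le> 1 * 1 * (2 * m)"
    unfolding potential_kernel_def
    by (rule integral_component_product_cube_le[OF Om continuous_landau_reflect continuous_landau_reflect c];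
        (assumption | intro landau_nonneg_near integral_landau_slice antiderivative_increment x x2 i3))
  then show ?thesis by simp
qed

lemma potential_kernel_column:
  assumes Om: "\<Omega> \<in> sets lebesgue" "\<And>x i. x \<in> \<Omega> \<Longrightarrow> \<bar>x $ i\<bar> \<le> m" and y: "\<And>i. \<bar>y $ i\<bar> \<le> m"
  shows "(LINT x|lebesgue_on \<Omega>. potential_kernel (landau R n) P a x y) \<le> 2 * m"
proof -
  have y2: "\<bar>y $ i\<bar> \<le> 2 * m" for i using y[of i] m by simp
  have Pc: "continuous_on UNIV P" using P(2) by (rule continuous_polynomial)
  have c: "continuous_on UNIV (\<lambda>t. P (t - y $ 3) - P (a - y $ 3))"
    by (intro continuous_on_diff continuous_on_compose2[OF Pc] continuous_intros) auto
  have "integral {-m..m} (\<lambda>t. P (t - y $ 3) - P (a - y $ 3)) \<le> integral {-m..m} (\<lambda>t. 1)"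
    using y antiderivative_increment(2) c
    by (intro integral_le integrable_continuous_real) (auto intro: continuous_on_subset simp: abs_le_iff)
  then have i3: "integral {-m..m} (\<lambda>t. P (t - y $ 3) - P (a - y $ 3)) \<le> 2 * m" using m by simp
  have ev: "landau R n (x $ i - y $ i) = landau R n (y $ i - x $ i)" for x i
    using landau_even[of R n "x $ i - y $ i"] by simp
  have "(LINT x|lebesgue_on \<Omega>. potential_kernel (landau R n) P a x y) \<le> 1 * 1 * (2 * m)"
    unfolding potential_kernel_def ev
    by (rule integral_component_product_cube_le[OF Om continuous_landau_reflect continuous_landau_reflect c];
        (assumption | intro landau_nonneg_near integral_landau_slice antiderivative_increment y y2 i3))
  then show ?thesis by simp
qed

end

lemma smooth_field_continuous: "smooth_field \<Phi> \<Longrightarrow> continuous_on UNIV \<Phi>"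
  using continuous_on_vec_lambda[of UNIV "\<lambda>i x. \<Phi> x $ i"]
  by (auto simp: smooth_field_def smooth_continuous)

lemma smooth_field_curl: "smooth_field \<Phi> \<Longrightarrow> smooth_field (curl \<Phi>)"
proof -
  assume \<Phi>: "smooth_field \<Phi>"
  have d: "smooth (\<lambda>x. u x - v x)" if "smooth u" "smooth v" for u v
    using smooth_add[OF that(1) smooth_mult[OF smooth_const[of "-1"] that(2)]] by simp
  have "smooth (partial i (\<lambda>y. \<Phi> y $ j))" for i j
    using \<Phi> by (auto simp: smooth_field_def intro: smooth_partial)
  then show ?thesis unfolding curl_def[abs_def] by (intro smooth_field_vector d)
qed

lemma L2_integrable:
  assumes Om: "bounded \<Omega>" "\<Omega> \<in> sets lebesgue" and f: "f \<in> L2 \<Omega>"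
  shows "integrable (lebesgue_on \<Omega>) f"
proof (rule Bochner_Integration.integrable_bound)
  show "integrable (lebesgue_on \<Omega>) (\<lambda>x. 1 + (norm (f x))\<^sup>2)"
    using Om f integrable_continuous_bounded[OF Om, of "\<lambda>_. 1"] by (simp add: L2_def)
  show "f \<in> borel_measurable (lebesgue_on \<Omega>)" using f by (simp add: L2_def)
  have "t \<le> 1 + t\<^sup>2" for t :: real using zero_le_power2[of "t - 1/2"] by (simp add: power2_eq_square algebra_simps)
  then show "AE x in lebesgue_on \<Omega>. norm (f x) \<le> norm (1 + (norm (f x))\<^sup>2)"
    by (simp add: abs_of_nonneg)
qed

section \<open>The helicity estimate\<close>

lemma norm_real3_squared: "(norm (v::real^3))\<^sup>2 = (v $ 1)\<^sup>2 + (v $ 2)\<^sup>2 + (v $ 3)\<^sup>2"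
  unfolding power2_norm_eq_inner inner_vec_def by (simp add: sum_3 power2_eq_square)

text \<open>
  The identity for the test fields reads \<open>curl A = w\<close> on the whole space once \<open>A\<close> and \<open>w\<close> are
  extended by zero. Taking for the test field the potential \<open>\<Phi> n\<close> of the mollified \<open>w\<close> gives
  \<open>\<integral> A \<bullet> curl (\<Phi> n) = \<integral> w \<bullet> \<Phi> n\<close>. The left side converges to \<open>\<integral> A \<bullet> w\<close> by dominated
  convergence: the mollified field is uniformly bounded, and it converges at every point of essential
  continuity of \<open>w\<close>. The right side is a quadratic form in \<open>w\<close> alone, and the Schur test bounds it.
\<close>

lemma helicity_bound:
  fixes A w :: "real^3 \<Rightarrow> real^3"
  assumes Om: "bounded \<Omega>" "open \<Omega>" and m: "m > 0" "\<And>x i. x \<in> \<Omega> \<Longrightarrow> \<bar>x $ i\<bar> \<le> m"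
    and A: "A \<in> L2 \<Omega>" and w: "w \<in> L2 \<Omega>"
    and wb: "AE x in lebesgue_on \<Omega>. norm (w x) \<le> N"
    and cont: "AE x in lebesgue_on \<Omega>. \<forall>\<epsilon>>0. \<exists>\<delta>>0.
      AE y in lebesgue_on \<Omega>. dist y x < \<delta> \<longrightarrow> norm (w y - w x) \<le> \<epsilon>"
    and weak: "\<And>\<Phi>. smooth_field \<Phi> \<Longrightarrow>
      (LINT x|lebesgue_on \<Omega>. A x \<bullet> curl \<Phi> x) = (LINT x|lebesgue_on \<Omega>. w x \<bullet> \<Phi> x)"
  shows "(LINT x|lebesgue_on \<Omega>. A x \<bullet> w x) \<le> 2 * m * (LINT x|lebesgue_on \<Omega>. (norm (w x))\<^sup>2)"
proof -
  let ?M = "lebesgue_on \<Omega>"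
  define R where "R = 3 * m"
  define a where "a = - 2 * m"
  have R: "R > 0" using m by (simp add: R_def)
  have ms: "\<Omega> \<in> sets lebesgue" using Om by (simp add: borel_open sets_completionI_sets)
  have inO: "AE x in ?M. x \<in> \<Omega>" by (auto simp: space_restrict_space intro!: AE_I2)
  define N' where "N' = \<bar>N\<bar>"
  have N': "0 \<le> N'" by (simp add: N'_def)
  have wi: "integrable ?M w" using Om(1) ms w by (rule L2_integrable)
  have wc: "integrable ?M (\<lambda>x. w x $ i)" for i using wi by (rule integrable_component)
  have wcb: "AE x in ?M. \<bar>w x $ i\<bar> \<le> N'" for i
    using wb
  proof eventually_elim
    case (elim x)
    with component_le_norm_cart[of "w x" i] show ?case by (simp add: N'_def)
  qed
  have "\<exists>F. (\<forall>t. (F has_real_derivative landau R n t) (at t)) \<and> real_polynomial_function F" for n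
    by (rule polynomial_antiderivative[OF polynomial_landau[of R n]]) blast
  then obtain P where P: "\<And>n t. (P n has_real_derivative landau R n t) (at t)" "\<And>n. real_polynomial_function (P n)"
    by metis
  note polyL = polynomial_landau[of R]
  define k where "k n = potential_kernel (landau R n) (P n) a" for n
  define \<Phi> where "\<Phi> n = potential \<Omega> (landau R n) (P n) a w" for n
  have sep: "separable (k n)" for n
    unfolding k_def using polyL P(2) by (rule separable_potential_kernel)
  have \<Phi>: "smooth_field (\<Phi> n)" for n
    unfolding \<Phi>_def using polyL P(2) Om(1) wi by (rule smooth_field_potential)
  have \<Phi>L2: "\<Phi> n \<in> L2 \<Omega>" for n
    using Om(1) ms smooth_field_continuous[OF \<Phi>] by (rule bounded_continuous_L2)
  have step: "(LINT x|?M. A x \<bullet> curl (\<Phi> n) x) \<le> 2 * m * (LINT x|?M. (norm (w x))\<^sup>2)" for n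
  proof -
    \<comment> \<open>The kernel sits between \<open>w x\<close> and \<open>w y\<close> turned by a right angle in the first two components,
    so \<open>w \<bullet> \<Phi> n\<close> integrates the kernel against this antisymmetric form.\<close>
    define b where "b x y = w x $ 1 * w y $ 2 - w x $ 2 * w y $ 1" for x y
    have b: "w x \<bullet> \<Phi> n x = (LINT y|?M. k n x y * b x y)" for x
    proof -
      have i: "integrable ?M (\<lambda>y. k n x y * w y $ j)" for j
        using sep Om(1) wc by (rule separable_integrable)
      have "w x \<bullet> \<Phi> n x = w x $ 1 * (LINT y|?M. k n x y * w y $ 2) - w x $ 2 * (LINT y|?M. k n x y * w y $ 1)"
        unfolding \<Phi>_def potential_def k_def[symmetric] by (simp add: inner_vec_def sum_3 vector_3)
      also have "\<dots> = (LINT y|?M. w x $ 1 * (k n x y * w y $ 2) - w x $ 2 * (k n x y * w y $ 1))"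
        using i by simp
      finally show ?thesis by (simp add: b_def algebra_simps)
    qed
    have "(LINT x|?M. LINT y|?M. k n x y * b x y) \<le> 2 * m * (LINT x|?M. (norm (w x))\<^sup>2)"
    proof (rule schur_test[OF sep Om(1) ms])
      show "integrable ?M (\<lambda>x. (norm (w x))\<^sup>2)" using w by (simp add: L2_def)
      show "0 \<le> k n x y" if "x \<in> \<Omega>" "y \<in> \<Omega>" for x y
        unfolding k_def using that m by (intro potential_kernel_nonneg[OF m(1) R_def a_def P]) auto
      show "(LINT y|?M. k n x y) \<le> 2 * m" if "x \<in> \<Omega>" for x
        unfolding k_def using that m ms by (intro potential_kernel_row[OF m(1) R_def a_def P]) auto
      show "(LINT x|?M. k n x y) \<le> 2 * m" if "y \<in> \<Omega>" for y
        unfolding k_def using that m ms by (intro potential_kernel_column[OF m(1) R_def a_def P]) auto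
      show "b x y \<le> ((norm (w x))\<^sup>2 + (norm (w y))\<^sup>2) / 2" for x y
      proof -
        have "((norm (w x))\<^sup>2 + (norm (w y))\<^sup>2) / 2 - b x y
            = ((w x $ 1 - w y $ 2)\<^sup>2 + (w x $ 2 + w y $ 1)\<^sup>2 + (w x $ 3)\<^sup>2 + (w y $ 3)\<^sup>2) / 2"
          unfolding norm_real3_squared b_def by (simp add: power2_eq_square field_simps)
        moreover have "\<dots> \<ge> 0" by simp
        ultimately show ?thesis by linarith
      qed
      show "integrable ?M (\<lambda>y. k n x y * b x y)" for x
        unfolding b_def
        by (intro separable_integrable[OF sep Om(1)] Bochner_Integration.integrable_diff integrable_mult_right wc)
      show "integrable ?M (\<lambda>x. LINT y|?M. k n x y * b x y)"
        using integrable_L2_inner[OF w \<Phi>L2[of n]] by (simp add: b)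
    qed auto
    then show ?thesis using weak[OF \<Phi>, of n] by (simp add: b)
  qed
  define V where "V n x i = (LINT y|?M. (\<Prod>j\<in>UNIV. landau R n (x $ j - y $ j)) * w y $ i)" for n and x :: "real^3" and i
  define T where "T n x = (LINT y|?M. landau R n (x $ 1 - y $ 1) * landau R n (x $ 2 - y $ 2) * landau R n (a - y $ 3) * w y $ 3)"
    for n and x :: "real^3"
  have curl\<Phi>: "curl (\<Phi> n) x = (\<chi> i. V n x i) - axis 3 (T n x)" for n x
    unfolding \<Phi>_def V_def T_def by (rule curl_potential[OF polyL P(2,1) Om(1) wi weak])
  have c3: "continuous_on UNIV (\<lambda>y::real^3. landau R n (p - y $ 1) * landau R n (q - y $ 2) * landau R n (r - y $ 3))" for n p q r
    by (intro continuous_on_mult continuous_component continuous_reflect continuous_landau)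
  have x2: "\<bar>x $ i\<bar> \<le> 2 * m" if "x \<in> \<Omega>" for x i using m(1) m(2)[OF that, of i] by simp
  have a2: "\<bar>a\<bar> \<le> 2 * m" using m by (simp add: a_def)
  note near = landau_nonneg_near[OF m(1) R_def a_def P]
  note moll = integral_mollifier_le[OF m(1) R_def a_def P ms m(2)]
  note slice = integral_landau_slice[OF m(1) R_def a_def P]
  have Vb: "\<bar>V n x i\<bar> \<le> 1 * N'" if x: "x \<in> \<Omega>" for n x i
    unfolding V_def UNIV_3_prod
    by (intro integral_weighted_bound Om(1) ms c3 N' wc wcb moll x2[OF x] slice mult_nonneg_nonneg near m(2))
  have Tb: "\<bar>T n x\<bar> \<le> c * N'" if x: "x \<in> \<Omega>" and c: "integral {-m..m} (\<lambda>t. landau R n (a - t)) \<le> c" for n x c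
    unfolding T_def
    by (intro integral_weighted_bound Om(1) ms c3 N' wc wcb moll x2[OF x] a2 c mult_nonneg_nonneg near m(2))
  have T0: "(\<lambda>n. T n x) \<longlonglongrightarrow> 0" if x: "x \<in> \<Omega>" for x
  proof (rule LIMSEQ_I)
    fix e :: real assume e: "e > 0"
    \<comment> \<open>Chosen such that \<open>2 m \<epsilon> N' < e\<close>; the summand 1 covers the case that \<open>N'\<close> vanishes.\<close>
    define \<epsilon> where "\<epsilon> = e / (4 * m * (N' + 1))"
    have eps: "\<epsilon> > 0" using e m N' by (simp add: \<epsilon>_def)
    have small: "2 * m * \<epsilon> * N' < e"
    proof -
      have "2 * m * \<epsilon> * N' \<le> 2 * m * \<epsilon> * (N' + 1)" using m eps by (intro mult_left_mono) auto
      also have "\<dots> = \<epsilon> * (4 * m * (N' + 1)) / 2" by simp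
      also have "\<epsilon> * (4 * m * (N' + 1)) = e"
      proof -
        have "4 * m * (N' + 1) \<noteq> 0" using m(1) N' by simp
        then show ?thesis unfolding \<epsilon>_def by (rule nonzero_eq_divide_eq[THEN iffD1, OF _ refl])
      qed
      finally show ?thesis using e by simp
    qed
    have "eventually (\<lambda>n. \<forall>s. m \<le> \<bar>s\<bar> \<and> \<bar>s\<bar> \<le> R \<longrightarrow> landau R n s \<le> \<epsilon>) sequentially"
      using R m eps by (intro landau_tail) (auto simp: R_def)
    then have "eventually (\<lambda>n. norm (T n x - 0) < e) sequentially"
    proof eventually_elim
      case (elim n)
      have "integral {-m..m} (\<lambda>t. landau R n (a - t)) \<le> integral {-m..m} (\<lambda>t. \<epsilon>)"
      proof (intro integral_le integrable_continuous_real continuous_on_const)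
        show "continuous_on {-m..m} (\<lambda>t. landau R n (a - t))"
          using continuous_reflect[OF continuous_landau] by (rule continuous_on_subset) simp
        show "landau R n (a - t) \<le> \<epsilon>" if "t \<in> {-m..m}" for t
          using elim that m by (auto simp: a_def R_def)
      qed
      then have "integral {-m..m} (\<lambda>t. landau R n (a - t)) \<le> 2 * m * \<epsilon>" using m by simp
      from Tb[OF x this] small show ?case by simp
    qed
    then show "\<exists>no. \<forall>n\<ge>no. norm (T n x - 0) < e" by (simp add: eventually_sequentially)
  qed
  have lim: "AE x in ?M. (\<lambda>n. A x \<bullet> curl (\<Phi> n) x) \<longlonglongrightarrow> A x \<bullet> w x"
    using cont inO
  proof eventually_elim
    case (elim x)
    have "(\<lambda>n. V n x i) \<longlonglongrightarrow> w x $ i" for i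
      unfolding V_def
    proof (rule approximate_identity[OF Om R elim(2)])
      show "\<bar>x $ j - y $ j\<bar> \<le> R" if "y \<in> \<Omega>" for y j
        using m(1) m(2)[OF that, of j] m(2)[OF elim(2), of j] by (simp add: R_def abs_le_iff)
      show "\<exists>\<delta>>0. AE y in ?M. dist y x < \<delta> \<longrightarrow> \<bar>w y $ i - w x $ i\<bar> \<le> \<epsilon>" if "\<epsilon> > 0" for \<epsilon>
      proof -
        obtain \<delta> where \<delta>: "\<delta> > 0" "AE y in ?M. dist y x < \<delta> \<longrightarrow> norm (w y - w x) \<le> \<epsilon>"
          using elim(1) \<open>\<epsilon> > 0\<close> by blast
        from \<delta>(2) have "AE y in ?M. dist y x < \<delta> \<longrightarrow> \<bar>w y $ i - w x $ i\<bar> \<le> \<epsilon>"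
        proof eventually_elim
          case (elim y)
          with component_le_norm_cart[of "w y - w x" i] show ?case by auto
        qed
        with \<delta>(1) show ?thesis by blast
      qed
    qed (use wc wcb in auto)
    then have "(\<lambda>n. (\<chi> i. V n x i) - axis 3 (T n x)) \<longlonglongrightarrow> w x"
    proof (intro vec_tendstoI)
      fix i
      assume "\<And>i. (\<lambda>n. V n x i) \<longlonglongrightarrow> w x $ i"
      then have "(\<lambda>n. V n x i - (if i = 3 then T n x else 0)) \<longlonglongrightarrow> w x $ i - (if i = 3 then 0 else 0)"
        using T0[OF elim(2)] by (cases "i = 3") (auto intro!: tendsto_diff tendsto_eq_intros)
      then show "(\<lambda>n. ((\<chi> i. V n x i) - axis 3 (T n x)) $ i) \<longlonglongrightarrow> w x $ i"
        by (simp add: axis_def if_distrib cong: if_cong)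
    qed
    then show ?case unfolding curl\<Phi> by (intro tendsto_inner tendsto_const)
  qed
  have curlb: "norm (curl (\<Phi> n) x) \<le> 6 * N'" if x: "x \<in> \<Omega>" for n x
  proof -
    have "norm (curl (\<Phi> n) x) \<le> (\<Sum>i\<in>UNIV. \<bar>curl (\<Phi> n) x $ i\<bar>)" by (rule norm_le_l1_cart)
    also have "\<dots> \<le> (\<Sum>i\<in>(UNIV::3 set). 2 * N')"
    proof (rule sum_mono)
      fix i :: 3
      have "\<bar>V n x i\<bar> \<le> N'" "\<bar>T n x\<bar> \<le> N'" using Vb[OF x] Tb[OF x slice[OF a2]] by auto
      then show "\<bar>curl (\<Phi> n) x $ i\<bar> \<le> 2 * N'" by (auto simp: curl\<Phi> axis_def)
    qed
    finally show ?thesis by simp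
  qed
  have "(\<lambda>n. LINT x|?M. A x \<bullet> curl (\<Phi> n) x) \<longlonglongrightarrow> (LINT x|?M. A x \<bullet> w x)"
  proof (rule integral_dominated_convergence[where w = "\<lambda>x. norm (A x) * (6 * N')"])
    show "(\<lambda>x. A x \<bullet> w x) \<in> borel_measurable ?M"
      using integrable_L2_inner[OF A w] by (rule borel_measurable_integrable)
    show "(\<lambda>x. A x \<bullet> curl (\<Phi> n) x) \<in> borel_measurable ?M" for n
      using A continuous_measurable_lebesgue_on[OF smooth_field_continuous[OF smooth_field_curl[OF \<Phi>]]]
      by (intro borel_measurable_inner) (auto simp: L2_def)
    show "integrable ?M (\<lambda>x. norm (A x) * (6 * N'))"
      using L2_integrable[OF Om(1) ms A] by (intro integrable_mult_left integrable_norm)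
    show "AE x in ?M. norm (A x \<bullet> curl (\<Phi> n) x) \<le> norm (A x) * (6 * N')" for n
      using inO
    proof eventually_elim
      case (elim x)
      have "norm (A x \<bullet> curl (\<Phi> n) x) \<le> norm (A x) * norm (curl (\<Phi> n) x)"
        using Cauchy_Schwarz_ineq2 by simp
      also have "\<dots> \<le> norm (A x) * (6 * N')" using curlb[OF elim] by (intro mult_left_mono) auto
      finally show ?case .
    qed
  qed (rule lim)
  then show ?thesis using step by (intro LIMSEQ_le_const2) auto
qed

section \<open>Piecewise polynomial fields\<close>

lemma mesh_AE:
  assumes "mesh \<Omega> \<T>" "\<Omega> \<in> sets lebesgue" and cell: "\<And>K. K \<in> \<T> \<Longrightarrow> AE x in lebesgue_on K. Q x"
  shows "AE x in lebesgue_on \<Omega>. Q x"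
proof -
  have T: "finite \<T>" "\<And>K. K \<in> \<T> \<Longrightarrow> open K" "negligible (\<Omega> - \<Union>\<T>)" using assms(1) by (auto simp: mesh_def)
  have "AE x in lebesgue. \<forall>K\<in>\<T>. x \<in> K \<longrightarrow> Q x"
    using T cell by (subst AE_finite_all) (auto simp: AE_lebesgue_on_iff[symmetric] borel_open sets_completionI_sets)
  moreover have "AE x in lebesgue. x \<notin> \<Omega> - \<Union>\<T>"
    using T(3) AE_not_in negligible_iff_null_sets by blast
  ultimately have "AE x in lebesgue. x \<in> \<Omega> \<longrightarrow> Q x" by eventually_elim blast
  then show ?thesis using assms(2) by (simp add: AE_lebesgue_on_iff)
qed

lemma piecewise_polynomial_bounded:
  fixes v :: "real^3 \<Rightarrow> 'b::euclidean_space"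
  assumes Om: "bounded \<Omega>" "\<Omega> \<in> sets lebesgue" and T: "mesh \<Omega> \<T>" and v: "piecewise_polynomial \<T> v"
  obtains N where "AE x in lebesgue_on \<Omega>. norm (v x) \<le> N"
proof -
  obtain p where p: "\<And>K. K \<in> \<T> \<Longrightarrow> polynomial_function (p K)"
    "\<And>K. K \<in> \<T> \<Longrightarrow> AE x in lebesgue_on K. v x = p K x"
    using v unfolding piecewise_polynomial_def by metis
  have TT: "finite \<T>" "\<And>K. K \<in> \<T> \<Longrightarrow> K \<subseteq> \<Omega>" using T by (auto simp: mesh_def)
  have "bounded (p K ` K)" if K: "K \<in> \<T>" for K
  proof -
    have "compact (p K ` closure \<Omega>)"
      using Om(1) continuous_on_polymonial_function[OF p(1)[OF K]]
      by (intro compact_continuous_image) auto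
    moreover have "p K ` K \<subseteq> p K ` closure \<Omega>"
      using TT(2)[OF K] closure_subset[of \<Omega>] by (intro image_mono) (rule subset_trans)
    ultimately show ?thesis using bounded_subset compact_imp_bounded by blast
  qed
  then have "bounded (\<Union>K\<in>\<T>. p K ` K)" using TT(1) by (intro bounded_UN) auto
  then obtain N where N: "\<And>K x. K \<in> \<T> \<Longrightarrow> x \<in> K \<Longrightarrow> norm (p K x) \<le> N"
    unfolding bounded_iff by blast
  have "AE x in lebesgue_on K. norm (v x) \<le> N" if K: "K \<in> \<T>" for K
  proof -
    have "AE x in lebesgue_on K. x \<in> K" by (auto simp: space_restrict_space intro!: AE_I2)
    with p(2)[OF K] show ?thesis by eventually_elim (simp add: N[OF K])
  qed
  then show thesis using mesh_AE[OF T Om(2)] that by blast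
qed

lemma piecewise_polynomial_AE_continuous:
  fixes v :: "real^3 \<Rightarrow> 'b::euclidean_space"
  assumes Om: "\<Omega> \<in> sets lebesgue" and T: "mesh \<Omega> \<T>" and v: "piecewise_polynomial \<T> v"
  shows "AE x in lebesgue_on \<Omega>. \<forall>\<epsilon>>0. \<exists>\<delta>>0.
      AE y in lebesgue_on \<Omega>. dist y x < \<delta> \<longrightarrow> norm (v y - v x) \<le> \<epsilon>"
proof (rule mesh_AE[OF T Om])
  fix K assume K: "K \<in> \<T>"
  then obtain p where p: "polynomial_function p" "AE x in lebesgue_on K. v x = p x"
    using v unfolding piecewise_polynomial_def by blast
  have "open K" using T K by (auto simp: mesh_def)
  then have ae: "AE y in lebesgue. y \<in> K \<longrightarrow> v y = p y"
    using p(2) by (simp add: AE_lebesgue_on_iff borel_open sets_completionI_sets)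
  have "AE x in lebesgue_on K. x \<in> K" by (auto simp: space_restrict_space intro!: AE_I2)
  with p(2) show "AE x in lebesgue_on K. \<forall>\<epsilon>>0. \<exists>\<delta>>0.
      AE y in lebesgue_on \<Omega>. dist y x < \<delta> \<longrightarrow> norm (v y - v x) \<le> \<epsilon>"
  proof eventually_elim
    case (elim x)
    show ?case
    proof (intro allI impI)
      fix \<epsilon> :: real assume "\<epsilon> > 0"
      obtain r where r: "r > 0" "ball x r \<subseteq> K" using \<open>open K\<close> elim open_contains_ball by blast
      have "continuous_on UNIV p" using p(1) by (rule continuous_on_polymonial_function)
      then obtain d where d: "d > 0" "\<And>y. dist y x < d \<Longrightarrow> dist (p y) (p x) < \<epsilon>"
        using \<open>\<epsilon> > 0\<close> unfolding continuous_on_iff by (metis UNIV_I)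
      from ae have "AE y in lebesgue. y \<in> \<Omega> \<longrightarrow> dist y x < min r d \<longrightarrow> norm (v y - v x) \<le> \<epsilon>"
      proof eventually_elim
        case (elim y)
        show ?case
        proof (intro impI)
          assume "dist y x < min r d"
          then have "y \<in> K" "norm (p y - p x) \<le> \<epsilon>"
            using r d(2)[of y] by (auto simp: dist_commute dist_norm[symmetric] subset_iff)
          then show "norm (v y - v x) \<le> \<epsilon>" using elim \<open>v x = p x\<close> by simp
        qed
      qed
      then show "\<exists>\<delta>>0. AE y in lebesgue_on \<Omega>. dist y x < \<delta> \<longrightarrow> norm (v y - v x) \<le> \<epsilon>"
        using r(1) d(1) Om by (intro exI[of _ "min r d"]) (simp add: AE_lebesgue_on_iff)
    qed
  qed
qed

text \<open>
  On each cell the difference agrees with a polynomial, so the fundamental lemma applies cell by cell.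
\<close>

lemma weak_curl_unique:
  assumes Om: "bounded \<Omega>" "\<Omega> \<in> sets lebesgue" and T: "mesh \<Omega> \<T>"
    and B: "has_weak_curl \<Omega> A B" "piecewise_polynomial \<T> B"
    and w: "has_weak_curl \<Omega> A w" "piecewise_polynomial \<T> w"
  shows "AE x in lebesgue_on \<Omega>. B x = w x"
proof (rule mesh_AE[OF T Om(2)])
  fix K assume K: "K \<in> \<T>"
  obtain p where p: "polynomial_function p" "AE x in lebesgue_on K. B x = p x"
    using B(2) K unfolding piecewise_polynomial_def by blast
  obtain q where q: "polynomial_function q" "AE x in lebesgue_on K. w x = q x"
    using w(2) K unfolding piecewise_polynomial_def by blast
  have L2: "B \<in> L2 \<Omega>" "w \<in> L2 \<Omega>" using B w by (auto simp: has_weak_curl_def)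
  have "AE x in lebesgue_on K. B x - w x = 0"
  proof (rule fundamental_lemma[OF Om, where p = "\<lambda>x. p x - q x"])
    show "open K" "K \<subseteq> \<Omega>" using T K by (auto simp: mesh_def)
    show "(\<lambda>x. B x - w x) \<in> L2 \<Omega>" using L2 by (rule L2_diff)
    show "continuous_on K (\<lambda>x. p x - q x)"
      using p(1) q(1) by (intro continuous_on_diff continuous_on_polymonial_function)
    show "AE x in lebesgue_on K. B x - w x = p x - q x"
      using p(2) q(2) by eventually_elim simp
    fix \<Phi> :: "real^3 \<Rightarrow> real^3" assume \<Phi>: "smooth_field \<Phi>" "compact_support_in \<Omega> \<Phi>"
    have "\<Phi> \<in> L2 \<Omega>" using Om smooth_field_continuous[OF \<Phi>(1)] by (rule bounded_continuous_L2)
    then have "(LINT x|lebesgue_on \<Omega>. (B x - w x) \<bullet> \<Phi> x)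
        = (LINT x|lebesgue_on \<Omega>. B x \<bullet> \<Phi> x) - (LINT x|lebesgue_on \<Omega>. w x \<bullet> \<Phi> x)"
      using L2 by (simp add: inner_diff_left integrable_L2_inner)
    also have "\<dots> = 0" using B(1) w(1) \<Phi> by (simp add: has_weak_curl_def)
    finally show "(LINT x|lebesgue_on \<Omega>. (B x - w x) \<bullet> \<Phi> x) = 0" .
  qed
  then show "AE x in lebesgue_on K. B x = w x" by simp
qed

text \<open>
  By definition of \<open>H\<^sub>0(curl)\<close> the potential \<open>A\<close> has some weak curl \<open>w\<close> for which the trace vanishes.
  Exactness puts \<open>w\<close> into the space of discrete fluxes, so it is piecewise polynomial, and therefore
  equals \<open>B\<close>. The bound obtained from a cube around \<open>\<Omega>\<close> does not involve the discretisation.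
\<close>

theorem proposition1:
  fixes \<Omega> :: "(real^3) set"
    and Vgrad Q :: "'h \<Rightarrow> (real^3 \<Rightarrow> real) set"
    and Vcurl Vdiv :: "'h \<Rightarrow> (real^3 \<Rightarrow> real^3) set"
  assumes "lipschitz_domain \<Omega>" and "bounded \<Omega>" and "contractible \<Omega>"
    and "\<And>h. exact_discrete_de_Rham \<Omega> (Vgrad h) (Vcurl h) (Vdiv h) (Q h)"
  shows "\<exists>C>0. \<forall>h. \<forall>B\<in>Vdiv h. has_weak_div \<Omega> B (\<lambda>_. 0) \<longrightarrow>
           (\<forall>A\<in>Vcurl h. has_weak_curl \<Omega> A B \<longrightarrow>
              (LINT x|lebesgue_on \<Omega>. B x \<bullet> A x) \<le> C * (L2_norm \<Omega> B)\<^sup>2)"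
proof -
  let ?M = "lebesgue_on \<Omega>"
  have "open \<Omega>" using assms(1) by (simp add: lipschitz_domain_def)
  then have ms: "\<Omega> \<in> sets lebesgue" by (simp add: borel_open sets_completionI_sets)
  obtain m where m: "m > 0" "\<And>x. x \<in> \<Omega> \<Longrightarrow> norm x \<le> m"
    using \<open>bounded \<Omega>\<close> bounded_pos by metis
  then have m': "\<bar>x $ i\<bar> \<le> m" if "x \<in> \<Omega>" for x i
    using that component_le_norm_cart[of x i] by fastforce
  have "(LINT x|?M. B x \<bullet> A x) \<le> 2 * m * (L2_norm \<Omega> B)\<^sup>2"
    if B: "B \<in> Vdiv h" and A: "A \<in> Vcurl h" and curl: "has_weak_curl \<Omega> A B" for h A B
  proof -
    obtain \<T> where T: "mesh \<Omega> \<T>" and V: "fe_subspace \<Omega> \<T> (H0_curl \<Omega>) (Vcurl h)"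
        "fe_subspace \<Omega> \<T> (H0_div \<Omega>) (Vdiv h)"
      and ex: "{w. \<exists>v\<in>Vcurl h. has_weak_curl \<Omega> v w} = {w \<in> Vdiv h. has_weak_div \<Omega> w (\<lambda>_. 0)}"
      using assms(4)[of h] unfolding exact_discrete_de_Rham_def by blast
    have "A \<in> H0_curl \<Omega>" using V(1) A unfolding fe_subspace_def by blast
    then obtain w where w: "has_weak_curl \<Omega> A w" "\<And>\<Phi>. smooth_field \<Phi> \<Longrightarrow> trace_curl \<Omega> A w \<Phi> = 0"
      by (auto simp: H0_curl_def)
    have "w \<in> Vdiv h" using ex A w(1) by blast
    then have pp: "piecewise_polynomial \<T> B" "piecewise_polynomial \<T> w"
      using V(2) B unfolding fe_subspace_def by blast+
    have eq: "AE x in ?M. B x = w x"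
      using weak_curl_unique[OF \<open>bounded \<Omega>\<close> ms T curl pp(1) w(1) pp(2)] .
    have L2: "A \<in> L2 \<Omega>" "B \<in> L2 \<Omega>" "w \<in> L2 \<Omega>"
      using curl w(1) by (auto simp: has_weak_curl_def)
    obtain N where N: "AE x in ?M. norm (w x) \<le> N"
      using piecewise_polynomial_bounded[OF \<open>bounded \<Omega>\<close> ms T pp(2)] .
    have "(LINT x|?M. A x \<bullet> w x) \<le> 2 * m * (LINT x|?M. (norm (w x))\<^sup>2)"
    proof (rule helicity_bound[OF \<open>bounded \<Omega>\<close> \<open>open \<Omega>\<close> m(1) m' L2(1,3) N
          piecewise_polynomial_AE_continuous[OF ms T pp(2)]])
      show "(LINT x|?M. A x \<bullet> curl \<Phi> x) = (LINT x|?M. w x \<bullet> \<Phi> x)" if "smooth_field \<Phi>" for \<Phi>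
        using w(2)[OF that] by (simp add: trace_curl_def)
    qed
    moreover have "(LINT x|?M. B x \<bullet> A x) = (LINT x|?M. A x \<bullet> w x)"
    proof (rule integral_cong_AE)
      show "AE x in ?M. B x \<bullet> A x = A x \<bullet> w x"
        using eq by eventually_elim (simp add: inner_commute)
    qed (use integrable_L2_inner[OF L2(2,1)] integrable_L2_inner[OF L2(1,3)] in auto)
    moreover have "(LINT x|?M. (norm (B x))\<^sup>2) = (LINT x|?M. (norm (w x))\<^sup>2)"
    proof (rule integral_cong_AE)
      show "AE x in ?M. (norm (B x))\<^sup>2 = (norm (w x))\<^sup>2" using eq by eventually_elim simp
    qed (use L2 in \<open>auto simp: L2_def\<close>)
    moreover have "(L2_norm \<Omega> B)\<^sup>2 = (LINT x|?M. (norm (B x))\<^sup>2)"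
      unfolding L2_norm_def by (intro real_sqrt_pow2 integral_nonneg_AE) simp
    ultimately show ?thesis by simp
  qed
  then show ?thesis using m(1) by (intro exI[of _ "2 * m"]) auto
qed

end
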